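(* Let $k\ge 3$ be an odd integer. If $G$ is a connected graph of order $n$, size $m$, and with maximum degree $\Delta(G)\le k$, then $$\alpha'(G) \ge \left(\frac{k-1}{k(k^2-3)}\right) n + \left(\frac{k^2-k-2}{k(k^2-3)}\right) m - \frac{k-1}{k(k^2-3)}.$$ Further, this lower bound is achieved (holds with equality) for infinitely many trees (with maximum degree at most $k$), and for infinitely many connected $k$-regular graphs.
   Context: Graphs are finite, simple and undirected, with at least one vertex. The order of a graph is its number of vertices and the size is its number of edges. The matching number $\alpha'(G)$ is the maximum number of edges in a matching of $G$. "Infinitely many" means infinitely many pairwise non-isomorphic graphs. *)

theory Defs
  imports Complex_Main
begin

record 'a ugraph =
  verts :: "'a set"
  edges :: "'a set set"

definition simple_graph :: "'a ugraph \<Rightarrow> bool" where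
  "simple_graph G \<longleftrightarrow> finite (verts G) \<and> verts G \<noteq> {} \<and>
     (\<forall>e\<in>edges G. e \<subseteq> verts G \<and> card e = 2)"

definition vdegree :: "'a ugraph \<Rightarrow> 'a \<Rightarrow> nat" where
  "vdegree G v = card {e \<in> edges G. v \<in> e}"

definition max_degree :: "'a ugraph \<Rightarrow> nat" where
  "max_degree G = Max (vdegree G ` verts G)"

definition regular :: "nat \<Rightarrow> 'a ugraph \<Rightarrow> bool" where
  "regular r G \<longleftrightarrow> (\<forall>v\<in>verts G. vdegree G v = r)"

definition adj_rel :: "'a ugraph \<Rightarrow> ('a \<times> 'a) set" where
  "adj_rel G = {(u, v). {u, v} \<in> edges G}"

definition connected_graph :: "'a ugraph \<Rightarrow> bool" where
  "connected_graph G \<longleftrightarrow> (\<forall>u\<in>verts G. \<forall>v\<in>verts G. (u, v) \<in> (adj_rel G)\<^sup>*)"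

definition is_cycle :: "'a ugraph \<Rightarrow> 'a list \<Rightarrow> bool" where
  "is_cycle G c \<longleftrightarrow> length c \<ge> 3 \<and> distinct c \<and> set c \<subseteq> verts G \<and>
     (\<forall>i<length c. {c ! i, c ! (Suc i mod length c)} \<in> edges G)"

definition tree :: "'a ugraph \<Rightarrow> bool" where
  "tree G \<longleftrightarrow> simple_graph G \<and> connected_graph G \<and> (\<nexists>c. is_cycle G c)"

definition is_matching :: "'a ugraph \<Rightarrow> 'a set set \<Rightarrow> bool" where
  "is_matching G M \<longleftrightarrow> M \<subseteq> edges G \<and> pairwise disjnt M"

definition matching_number :: "'a ugraph \<Rightarrow> nat" where
  "matching_number G = Max {card M | M. is_matching G M}"

definition isomorphic :: "'a ugraph \<Rightarrow> 'b ugraph \<Rightarrow> bool" where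
  "isomorphic G H \<longleftrightarrow> (\<exists>f. bij_betw f (verts G) (verts H) \<and>
     (\<forall>u\<in>verts G. \<forall>v\<in>verts G. {u, v} \<in> edges G \<longleftrightarrow> {f u, f v} \<in> edges H))"

text \<open>Every finite graph has an isomorphic copy with vertices in \<open>nat\<close>, so it is no
  restriction to take the pairwise non-isomorphic witnesses over that type.\<close>

definition infinitely_many_graphs :: "(nat ugraph \<Rightarrow> bool) \<Rightarrow> bool" where
  "infinitely_many_graphs P \<longleftrightarrow> (\<exists>\<G>. infinite \<G> \<and> (\<forall>G\<in>\<G>. P G) \<and>
     pairwise (\<lambda>G H. \<not> isomorphic G H) \<G>)"

definition matching_bound :: "nat \<Rightarrow> nat \<Rightarrow> nat \<Rightarrow> real" where
  "matching_bound k n m =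
     (real k - 1) / (real k * ((real k)\<^sup>2 - 3)) * real n
     + ((real k)\<^sup>2 - real k - 2) / (real k * ((real k)\<^sup>2 - 3)) * real m
     - (real k - 1) / (real k * ((real k)\<^sup>2 - 3))"

end

theory Submission
  imports Defs "HOL-Library.Countable"
begin

text \<open>Write the bound as \<open>a n + b m - a\<close>; then \<open>(a + b) k = 1\<close>. If some vertex \<open>v\<close> is covered by
  every maximum matching, deleting it lowers the matching number by one, loses \<open>deg v \<le> k\<close> edges and
  leaves at most \<open>deg v\<close> components, so the bound follows by induction. Otherwise Gallai's lemma gives
  \<open>n = 2 \<alpha>' + 1\<close>, and the bound follows from \<open>2 m \<le> n min(k, n - 1)\<close> and the parity of \<open>n k\<close>.

  The extremal graphs are tree-like around an independent set \<open>S\<close> of vertices of degree \<open>k\<close>: removing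
  \<open>S\<close> leaves only single vertices and, in the regular case, graphs on \<open>k + 2\<close> vertices joined to
  \<open>S\<close> by one edge. A matching has at most \<open>|S|\<close> edges meeting \<open>S\<close>, and at most \<open>(k + 1) / 2\<close> inside each
  graph on \<open>k + 2\<close> vertices.\<close>

section \<open>Matchings and Gallai's lemma\<close>

text \<open>The coefficients are forced by the two tight cases. Deleting an essential vertex of
  degree \<open>d\<close> costs \<open>b * d\<close> for its edges, \<open>a\<close> for the vertex
  and, with up to \<open>d\<close> components in place of one, \<open>a * (d - 1)\<close> for the
  constant terms. The matching number drops by at least one, so \<open>(a + b) * d \<le> 1\<close>
  suffices, tight for \<open>d = k\<close> when \<open>(a + b) * k = 1\<close>. In the Gallai case,
  with matching number \<open>t\<close>, the term \<open>- a\<close> cancels one vertex and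
  \<open>t \<ge> 2 * a * t + b * m\<close> remains. Parity gives
  \<open>2 * m \<le> (2 * t + 1) * k - 1\<close>; demanding equality at the least odd order above
  \<open>k\<close>, namely \<open>k + 2\<close>, gives
  \<open>(k + 1) * (1 - 2 * a - b * k) = b * (k - 1)\<close>. The stated \<open>a\<close> and
  \<open>b\<close> solve these two linear equations.

  The extremal graphs are tight throughout: every vertex of the separator has degree
  \<open>k\<close> and all its edges are bridges, and the pieces on \<open>k + 2\<close> vertices
  have degree sum \<open>k * (k + 2) - 1\<close>. No large matching is built in them: the lower
  bound itself supplies it, and the separator caps it.

  \<open>finite_graph\<close> allows an empty vertex set because a deletion may leave
  nothing.\<close>

definition finite_graph :: "'a ugraph \<Rightarrow> bool" where
  "finite_graph G \<longleftrightarrow> finite (verts G) \<and> (\<forall>e\<in>edges G. e \<subseteq> verts G \<and> card e = 2)"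

definition induced :: "'a ugraph \<Rightarrow> 'a set \<Rightarrow> 'a ugraph" where
  "induced G U = \<lparr>verts = U, edges = {e \<in> edges G. e \<subseteq> U}\<rparr>"

definition maximum_matching :: "'a ugraph \<Rightarrow> 'a set set \<Rightarrow> bool" where
  "maximum_matching G M \<longleftrightarrow> is_matching G M \<and> card M = matching_number G"

lemma induced_simps [simp]:
  "verts (induced G U) = U" "edges (induced G U) = {e \<in> edges G. e \<subseteq> U}"
  by (simp_all add: induced_def)

lemma finite_graph_induced: "finite_graph G \<Longrightarrow> U \<subseteq> verts G \<Longrightarrow> finite_graph (induced G U)"
  by (auto simp: finite_graph_def intro: finite_subset)

lemma finite_edges: "finite_graph G \<Longrightarrow> finite (edges G)"
  by (rule finite_subset[of _ "Pow (verts G)"]) (auto simp: finite_graph_def)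

lemma finite_edge: "finite_graph G \<Longrightarrow> e \<in> edges G \<Longrightarrow> finite e"
  by (metis card.infinite finite_graph_def zero_neq_numeral)

lemma finite_matching: "finite_graph G \<Longrightarrow> is_matching G M \<Longrightarrow> finite M"
  using finite_edges finite_subset unfolding is_matching_def by blast

lemma edge_verts:
  assumes "finite_graph G" "{u, v} \<in> edges G"
  shows "u \<in> verts G" "v \<in> verts G" "u \<noteq> v"
  using assms by (auto simp: finite_graph_def)

lemma edgeE:
  assumes "finite_graph G" "e \<in> edges G" "v \<in> e"
  obtains u where "e = {v, u}" "u \<noteq> v"
proof -
  have "card e = 2" using assms by (auto simp: finite_graph_def)
  then obtain x y where "e = {x, y}" "x \<noteq> y" by (auto simp: card_2_iff)
  with \<open>v \<in> e\<close> show ?thesis using that by (auto simp: insert_commute)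
qed

lemma finite_matching_sizes: "finite_graph G \<Longrightarrow> finite {card M | M. is_matching G M}"
proof -
  assume "finite_graph G"
  then have "finite (card ` Pow (edges G))" by (simp add: finite_edges)
  then show ?thesis by (rule rev_finite_subset) (auto simp: is_matching_def)
qed

lemma matching_card_le: "finite_graph G \<Longrightarrow> is_matching G M \<Longrightarrow> card M \<le> matching_number G"
  unfolding matching_number_def by (rule Max_ge) (auto intro: finite_matching_sizes)

lemma maximum_matching_exists:
  assumes "finite_graph G" obtains M where "maximum_matching G M"
proof -
  have "is_matching G {}" by (simp add: is_matching_def)
  then have "matching_number G \<in> {card M | M. is_matching G M}"
    unfolding matching_number_def by (intro Max_in finite_matching_sizes assms) blast
  then show ?thesis using that by (auto simp: maximum_matching_def)
qed

lemma matching_number_le: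
  assumes "finite_graph G" "\<And>M. is_matching G M \<Longrightarrow> card M \<le> c"
  shows "matching_number G \<le> c"
  using maximum_matching_exists[OF assms(1)] assms(2) by (metis maximum_matching_def)

lemma matching_unique:
  assumes "is_matching G M" "e \<in> M" "f \<in> M" "v \<in> e" "v \<in> f" shows "e = f"
  using assms unfolding is_matching_def pairwise_def disjnt_def by blast

lemma card_matched:
  assumes "finite_graph G" "is_matching G M"
  shows "card (\<Union>M) = 2 * card M"
proof -
  have "card (\<Union>M) = sum card M"
    using assms finite_edge[OF assms(1)]
    by (intro card_Union_disjoint) (auto simp: is_matching_def)
  also have "\<dots> = (\<Sum>e\<in>M. 2)"
    using assms by (intro sum.cong) (auto simp: is_matching_def finite_graph_def)
  finally show ?thesis by simp
qed

lemma matched_subset: "finite_graph G \<Longrightarrow> is_matching G M \<Longrightarrow> \<Union>M \<subseteq> verts G"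
  by (auto simp: is_matching_def finite_graph_def)

lemma matching_insert:
  assumes "finite_graph G" "is_matching G M" "e \<in> edges G" "e \<inter> \<Union>M = {}"
  shows "is_matching G (insert e M)" "card (insert e M) = card M + 1"
proof -
  show "is_matching G (insert e M)"
    using assms unfolding is_matching_def pairwise_insert disjnt_def by auto
  have "e \<noteq> {}" using assms by (auto simp: finite_graph_def)
  then have "e \<notin> M" using assms(4) by auto
  then show "card (insert e M) = card M + 1" using finite_matching[OF assms(1,2)] by simp
qed

lemma maximum_matching_edge:
  assumes "finite_graph G" "maximum_matching G M" "{u, v} \<in> edges G" "u \<notin> \<Union>M"
  shows "v \<in> \<Union>M"
proof (rule ccontr)
  assume "v \<notin> \<Union>M"
  with assms have "is_matching G (insert {u, v} M)" "card (insert {u, v} M) = card M + 1"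
    by (intro matching_insert; auto simp: maximum_matching_def)+
  then show False
    using matching_card_le[OF assms(1)] assms(2) by (fastforce simp: maximum_matching_def)
qed

text \<open>Among the maximum matchings missing \<open>t\<close>, one that agrees with \<open>M\<close> on as many edges as
  possible can still be pushed towards \<open>M\<close> by exchanging one edge, which is absurd.\<close>

lemma missed_transitive:
  assumes G: "finite_graph G" and M: "maximum_matching G M" "u \<notin> \<Union>M" "v \<notin> \<Union>M"
    and uv: "u \<in> verts G" "v \<in> verts G" "u \<noteq> v"
    and t: "maximum_matching G N0" "t \<notin> \<Union>N0"
    and ut: "\<And>N. maximum_matching G N \<Longrightarrow> t \<notin> \<Union>N \<Longrightarrow> u \<noteq> t \<Longrightarrow> u \<in> \<Union>N"
    and vt: "\<And>N. maximum_matching G N \<Longrightarrow> t \<notin> \<Union>N \<Longrightarrow> v \<noteq> t \<Longrightarrow> v \<in> \<Union>N"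
  shows False
proof -
  \<comment> \<open>If \<open>M\<close> missed \<open>t\<close>, the last two hypotheses would force
    both \<open>u = t\<close> and \<open>v = t\<close>.\<close>
  have tM: "t \<in> \<Union>M" using ut vt M uv(3) by metis
  define A where "A = {N. maximum_matching G N \<and> t \<notin> \<Union>N}"
  have "finite M" using M finite_matching[OF G] by (auto simp: maximum_matching_def)
  then have "\<forall>N. N \<in> A \<longrightarrow> card (M \<inter> N) < Suc (card M)"
    by (simp add: le_imp_less_Suc card_mono)
  moreover have "N0 \<in> A" using t by (simp add: A_def)
  ultimately obtain N where N: "N \<in> A" "\<And>N'. N' \<in> A \<Longrightarrow> card (M \<inter> N') \<le> card (M \<inter> N)"
    using ex_has_greatest_nat[of "\<lambda>N. N \<in> A" N0 "\<lambda>N. card (M \<inter> N)" "Suc (card M)"] by metis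
  have Nm: "maximum_matching G N" "t \<notin> \<Union>N" using N by (auto simp: A_def)
  have uN: "u \<in> \<Union>N" "v \<in> \<Union>N" using ut[OF Nm] vt[OF Nm] tM M by metis+
  have mat: "is_matching G M" "is_matching G N" "card M = card N"
    using M Nm by (auto simp: maximum_matching_def)
  have finV: "finite (verts G)" using G by (simp add: finite_graph_def)
  have fin: "finite (\<Union>M)" "finite (\<Union>N)"
    using finite_subset[OF matched_subset[OF G] finV] mat by blast+
  have card_eq: "card (\<Union>M) = card (\<Union>N)" using card_matched[OF G] mat by simp
  \<comment> \<open>Both matchings cover equally many vertices and only \<open>N\<close> covers
    \<open>u\<close> and \<open>v\<close>, so at least two vertices are covered only by
    \<open>M\<close>, one of them different from \<open>t\<close>.\<close>
  have "card (\<Union>M - \<Union>N) = card (\<Union>N - \<Union>M)"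
    using fin card_eq by (metis card_le_sym_Diff order.refl le_antisym)
  also have "\<dots> \<ge> card {u, v}" using uN M fin by (intro card_mono) auto
  finally have "card (\<Union>M - \<Union>N) \<ge> 2" using uv by simp
  then have "\<not> \<Union>M - \<Union>N \<subseteq> {t}" using card_mono[of "{t}" "\<Union>M - \<Union>N"] by auto
  then obtain x where x: "x \<in> \<Union>M" "x \<notin> \<Union>N" "x \<noteq> t" by auto
  then obtain e where e: "e \<in> M" "x \<in> e" by auto
  have eE: "e \<in> edges G" using e mat by (auto simp: is_matching_def)
  obtain y where y: "e = {x, y}" "y \<noteq> x" using edgeE[OF G eE e(2)] by metis
  have yN: "y \<in> \<Union>N" using maximum_matching_edge[OF G Nm(1)] eE y x by blast
  then obtain f where f: "f \<in> N" "y \<in> f" by auto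
  have fM: "f \<notin> M" using matching_unique[OF mat(1) e(1), of f y] f y x by blast
  \<comment> \<open>\<open>N\<close> misses the end \<open>x\<close> of \<open>e\<close>, and
    \<open>f\<close> is its edge at the other end \<open>y\<close>, so the swap gives a matching of
    the same size. It still misses \<open>t\<close>, as \<open>x\<close> is not \<open>t\<close> and
    \<open>y\<close> is covered by \<open>N\<close>. It gains \<open>e\<close> from \<open>M\<close>
    and loses \<open>f\<close>, which is not in \<open>M\<close>.\<close>
  define N' where "N' = insert e (N - {f})"
  have sub: "is_matching G (N - {f})"
    using mat(2) unfolding is_matching_def by (meson Diff_subset order_trans pairwise_subset)
  have "y \<notin> \<Union>(N - {f})" using matching_unique[OF mat(2) f(1) _ f(2)] by auto
  then have disj: "e \<inter> \<Union>(N - {f}) = {}" using y(1) x(2) by auto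
  have finN: "finite N" "finite M" using finite_matching[OF G] mat by auto
  have "is_matching G N'" "card N' = card (N - {f}) + 1"
    unfolding N'_def using matching_insert[OF G sub eE disj] by auto
  moreover have "card (N - {f}) + 1 = card N" using card_Suc_Diff1[OF finN(1) f(1)] by simp
  ultimately have "maximum_matching G N'" using Nm by (simp add: maximum_matching_def)
  moreover have "t \<notin> \<Union>N'"
    unfolding N'_def using y x Nm yN by auto
  ultimately have "card (M \<inter> N') \<le> card (M \<inter> N)"
    using N by (auto simp: A_def)
  moreover have "M \<inter> N' = insert e (M \<inter> N)" unfolding N'_def using e fM by auto
  moreover have "e \<notin> N" using x e by auto
  ultimately show False using finN by simp
qed

text \<open>No maximum matching misses two vertices: by \<open>missed_transitive\<close> this passes
  from a pair \<open>u\<close>, \<open>t\<close> to \<open>u\<close>, \<open>v\<close> whenever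
  \<open>t\<close> and \<open>v\<close> are adjacent, hence along paths. By hypothesis some maximum
  matching misses a vertex, so it misses exactly one.\<close>

theorem gallai_lemma:
  assumes G: "finite_graph G" "connected_graph G" "verts G \<noteq> {}"
    and missed: "\<And>v. v \<in> verts G \<Longrightarrow> \<exists>M. maximum_matching G M \<and> v \<notin> \<Union>M"
  shows "card (verts G) = 2 * matching_number G + 1"
proof -
  define P where "P u v \<longleftrightarrow> (\<forall>M. maximum_matching G M \<longrightarrow> u \<notin> \<Union>M \<longrightarrow> v \<notin> \<Union>M \<longrightarrow> u = v)" for u v
  have P: "v \<in> verts G \<and> P u v" if "(u, v) \<in> (adj_rel G)\<^sup>*" "u \<in> verts G" for u v
    using that
  proof (induction rule: rtrancl_induct)
    case base then show ?case by (simp add: P_def)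
  next
    case (step t v)
    then have tv: "t \<in> verts G" "P u t" "{t, v} \<in> edges G" by (auto simp: adj_rel_def)
    have v: "v \<in> verts G" using edge_verts[OF G(1) tv(3)] by simp
    obtain N0 where N0: "maximum_matching G N0" "t \<notin> \<Union>N0" using missed[OF tv(1)] by blast
    have "P u v" unfolding P_def
    proof (intro allI impI, rule ccontr)
      fix M assume M: "maximum_matching G M" "u \<notin> \<Union>M" "v \<notin> \<Union>M" and "u \<noteq> v"
      show False
      proof (rule missed_transitive[OF G(1) M step.prems v \<open>u \<noteq> v\<close> N0])
        show "u \<in> \<Union>N" if "maximum_matching G N" "t \<notin> \<Union>N" "u \<noteq> t" for N
          using tv(2) that unfolding P_def by metis
        show "v \<in> \<Union>N" if "maximum_matching G N" "t \<notin> \<Union>N" for N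
          using maximum_matching_edge[OF G(1) that(1) tv(3) that(2)] .
      qed
    qed
    with v show ?case by simp
  qed
  obtain v M where v: "v \<in> verts G" and M: "maximum_matching G M" "v \<notin> \<Union>M"
    using missed G(3) by blast
  have mat: "is_matching G M" "card M = matching_number G" using M by (auto simp: maximum_matching_def)
  have "x = v" if x: "x \<in> verts G" "x \<notin> \<Union>M" for x
  proof -
    have "P v x" using P[of v x] v x G(2) by (simp add: connected_graph_def)
    then show ?thesis using x M by (metis P_def)
  qed
  then have "verts G = insert v (\<Union>M)" using matched_subset[OF G(1) mat(1)] v by auto
  moreover have "finite (\<Union>M)"
    using matched_subset[OF G(1) mat(1)] G(1) by (auto simp: finite_graph_def intro: finite_subset)
  ultimately show ?thesis using card_matched[OF G(1) mat(1)] M mat by simp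
qed

section \<open>Degrees, reachability and induced subgraphs\<close>

lemma vdegree_eq_card_neighbours:
  assumes "finite_graph G" shows "vdegree G v = card {u. {v, u} \<in> edges G}"
proof -
  have "bij_betw (\<lambda>u. {v, u}) {u. {v, u} \<in> edges G} {e \<in> edges G. v \<in> e}"
    unfolding bij_betw_def
  proof
    show "inj_on (\<lambda>u. {v, u}) {u. {v, u} \<in> edges G}" by (auto simp: inj_on_def doubleton_eq_iff)
    show "(\<lambda>u. {v, u}) ` {u. {v, u} \<in> edges G} = {e \<in> edges G. v \<in> e}"
    proof
      show "{e \<in> edges G. v \<in> e} \<subseteq> (\<lambda>u. {v, u}) ` {u. {v, u} \<in> edges G}"
      proof
        fix e assume "e \<in> {e \<in> edges G. v \<in> e}"
        then have "e \<in> edges G" "v \<in> e" by auto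
        moreover from this obtain u where "e = {v, u}" by (rule edgeE[OF assms])
        ultimately show "e \<in> (\<lambda>u. {v, u}) ` {u. {v, u} \<in> edges G}" by blast
      qed
    qed auto
  qed
  then show ?thesis unfolding vdegree_def by (rule bij_betw_same_card[symmetric])
qed

lemma handshake:
  assumes G: "finite_graph G" shows "(\<Sum>v\<in>verts G. vdegree G v) = 2 * card (edges G)"
proof -
  have "(\<Sum>v\<in>verts G. vdegree G v) = (\<Sum>v\<in>verts G. \<Sum>e\<in>edges G. if v \<in> e then 1 else 0)"
    unfolding vdegree_def card_eq_sum sum.inter_filter[OF finite_edges[OF G]] ..
  also have "\<dots> = (\<Sum>e\<in>edges G. \<Sum>v\<in>verts G. if v \<in> e then 1 else 0)" by (rule sum.swap)
  also have "\<dots> = (\<Sum>e\<in>edges G. 2)"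
  proof (rule sum.cong)
    fix e assume "e \<in> edges G"
    then have "verts G \<inter> e = e" "card e = 2" using G by (auto simp: finite_graph_def)
    then show "(\<Sum>v\<in>verts G. if v \<in> e then 1 else 0) = (2::nat)"
      using G by (simp add: sum.If_cases finite_graph_def)
  qed simp
  finally show ?thesis by simp
qed

lemma vdegree_less_order:
  assumes G: "finite_graph G" and v: "v \<in> verts G" shows "vdegree G v \<le> card (verts G) - 1"
proof -
  have "card {u. {v, u} \<in> edges G} \<le> card (verts G - {v})"
    using G edge_verts[OF G] by (intro card_mono) (auto simp: finite_graph_def)
  then show ?thesis using v by (simp add: vdegree_eq_card_neighbours[OF G])
qed

lemma adj_rel_sym: "sym ((adj_rel G)\<^sup>*)"
  by (rule sym_rtrancl) (auto simp: sym_def adj_rel_def insert_commute)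

lemma vdegree_induced_le: "finite_graph G \<Longrightarrow> vdegree (induced G U) v \<le> vdegree G v"
  unfolding vdegree_def by (rule card_mono) (auto simp: finite_edges)

lemma matching_number_superadditive:
  assumes G: "finite_graph G" and AB: "A \<subseteq> verts G" "B \<subseteq> verts G" "A \<inter> B = {}"
  shows "matching_number (induced G A) + matching_number (induced G B) \<le> matching_number G"
proof -
  obtain M N where M: "maximum_matching (induced G A) M" and N: "maximum_matching (induced G B) N"
    using maximum_matching_exists finite_graph_induced[OF G] AB by metis
  have MA: "M \<subseteq> edges G" "\<Union>M \<subseteq> A" "N \<subseteq> edges G" "\<Union>N \<subseteq> B" "pairwise disjnt M" "pairwise disjnt N"
    using M N by (auto simp: maximum_matching_def is_matching_def)
  \<comment> \<open>The empty set could lie in both matchings, so edges must be nonempty before the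
    sizes are added.\<close>
  have "e \<noteq> {}" if "e \<in> M" for e using that MA(1) G by (force simp: finite_graph_def)
  then have disj: "M \<inter> N = {}" using MA AB(3) by fastforce
  have dis: "disjnt e f" if "e \<in> M" "f \<in> N" for e f
    using that MA AB(3) unfolding disjnt_def by blast
  have "is_matching G (M \<union> N)" unfolding is_matching_def
  proof
    show "pairwise disjnt (M \<union> N)"
      using MA(5,6) dis unfolding pairwise_def by (metis UnE disjnt_sym)
  qed (use MA in auto)
  then have "card (M \<union> N) \<le> matching_number G" by (rule matching_card_le[OF G])
  moreover have "card (M \<union> N) = card M + card N"
    using disj MA finite_edges[OF G] by (intro card_Un_disjoint) (auto intro: finite_subset)
  ultimately show ?thesis using M N by (simp add: maximum_matching_def)
qed

text \<open>A maximum matching of the remainder misses \<open>v\<close>, so it is not maximum in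
  \<open>G\<close>. The strict inequality is the unit gained in the induction.\<close>

lemma matching_number_delete_essential:
  assumes G: "finite_graph G" and v: "\<And>M. maximum_matching G M \<Longrightarrow> v \<in> \<Union>M"
  shows "matching_number (induced G (verts G - {v})) < matching_number G"
proof -
  obtain M where M: "maximum_matching (induced G (verts G - {v})) M"
    using maximum_matching_exists finite_graph_induced[OF G] by (metis Diff_subset)
  then have mat: "is_matching G M" "v \<notin> \<Union>M" by (auto simp: maximum_matching_def is_matching_def)
  then have "card M \<noteq> matching_number G" using v by (auto simp: maximum_matching_def)
  with matching_card_le[OF G mat(1)] M show ?thesis by (simp add: maximum_matching_def)
qed

section \<open>The lower bound\<close>

lemma coefficients:
  fixes k :: real assumes k: "k \<ge> 3"
  defines "a \<equiv> (k - 1) / (k * (k\<^sup>2 - 3))" and "b \<equiv> (k\<^sup>2 - k - 2) / (k * (k\<^sup>2 - 3))"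
  shows "a \<ge> 0" "b \<ge> 0" "(a + b) * k = 1" "(k + 1) * (1 - 2 * a - b * k) = b * (k - 1)"
    "1 - 2 * a - b * k \<ge> 0"
proof -
  have k2: "k\<^sup>2 \<ge> 3 * k" using k by (simp add: power2_eq_square)
  then have "k\<^sup>2 - 3 > 0" using k by linarith
  then have K: "k * (k\<^sup>2 - 3) > 0" using k by simp
  show "a \<ge> 0" unfolding a_def using K k by (intro divide_nonneg_pos) auto
  show "b \<ge> 0" unfolding b_def using K k k2 by (intro divide_nonneg_pos) linarith+
  define K where "K = k * (k\<^sup>2 - 3)"
  have K0: "K > 0" using K by (simp only: K_def)
  have aK: "a * K = k - 1" and bK: "b * K = k\<^sup>2 - k - 2"
    unfolding a_def b_def K_def[symmetric] using K0 by simp_all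
  have "((a + b) * k) * K = (a * K + b * K) * k" by (simp add: algebra_simps)
  also have "\<dots> = 1 * K" unfolding aK bK by (simp add: K_def algebra_simps power2_eq_square)
  finally show "(a + b) * k = 1" using K0 by simp
  have "(1 - 2 * a - b * k) * K = K - 2 * (a * K) - (b * K) * k" by (simp add: algebra_simps)
  also have "\<dots> = (k - 1) * (k - 2)"
    unfolding aK bK by (simp add: K_def algebra_simps power2_eq_square)
  finally have c: "(1 - 2 * a - b * k) * K = (k - 1) * (k - 2)" .
  then have "(1 - 2 * a - b * k) * K \<ge> 0" using k by simp
  then show "1 - 2 * a - b * k \<ge> 0" using K0 by (simp add: zero_le_mult_iff)
  \<comment> \<open>Here \<open>(k + 1) * (k - 2) = k\<^sup>2 - k - 2\<close>, which is
    \<open>b * K\<close>.\<close>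
  have "((k + 1) * (1 - 2 * a - b * k)) * K = (b * K) * (k - 1)"
    unfolding mult.assoc c bK by (simp add: algebra_simps power2_eq_square)
  also have "\<dots> = (b * (k - 1)) * K" by (simp only: mult_ac)
  finally show "(k + 1) * (1 - 2 * a - b * k) = b * (k - 1)" using K0 by simp
qed

text \<open>\<open>t\<close> stands for the matching number of a graph of order
  \<open>2 * t + 1\<close> and size \<open>m\<close>. Up to order \<open>k\<close> the complete
  graph limits \<open>m\<close>; beyond it the degree bound does, sharpened by parity.\<close>

lemma factor_critical_bound:
  fixes k t m :: nat and a b :: real
  assumes ab: "b \<ge> 0" "(real k + 1) * (1 - 2 * a - b * real k) = b * (real k - 1)"
      "1 - 2 * a - b * real k \<ge> 0"
    and k: "odd k" and m1: "2 * m \<le> (2 * t + 1) * k" and m2: "2 * m \<le> (2 * t + 1) * (2 * t)"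
  shows "real t \<ge> a * (2 * real t) + b * real m"
proof (cases "2 * t + 1 \<le> k")
  case True
  then have "(2 * t + 1) * (2 * t) \<le> k * (2 * t)" by (intro mult_right_mono) auto
  with m2 have "m \<le> k * t" by linarith
  then have "real m \<le> real (k * t)" by (rule of_nat_mono)
  then have "b * real m \<le> b * (real k * real t)" using ab by (intro mult_left_mono) auto
  moreover have "0 \<le> (1 - 2 * a - b * real k) * real t" using ab by simp
  ultimately show ?thesis by (simp add: algebra_simps)
next
  case False
  with k have t: "k + 1 \<le> 2 * t" by presburger
  \<comment> \<open>The even number \<open>2 * m\<close> is bounded by an odd one; the unit gained
    turns \<open>k\<close> into the \<open>k - 1\<close> of the second identity.\<close>
  have "odd ((2 * t + 1) * k)" using k by simp
  with m1 have "2 * m + 1 \<le> (2 * t + 1) * k" by presburger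
  then have "real (2 * m + 1) \<le> real ((2 * t + 1) * k)" by (rule of_nat_mono)
  then have "2 * real m \<le> 2 * real t * real k + (real k - 1)" by (simp add: algebra_simps)
  then have "b * (2 * real m) \<le> b * (2 * real t * real k + (real k - 1))"
    using ab by (intro mult_left_mono) auto
  also have "\<dots> = b * (2 * real t * real k) + (real k + 1) * (1 - 2 * a - b * real k)"
    using ab by (simp add: algebra_simps)
  \<comment> \<open>The order is at least \<open>k + 2\<close>, so \<open>2 * t\<close> may replace
    \<open>k + 1\<close>.\<close>
  also have "(real k + 1) * (1 - 2 * a - b * real k) \<le> real (2 * t) * (1 - 2 * a - b * real k)"
    using ab t by (intro mult_right_mono) linarith+
  finally show ?thesis by (simp add: algebra_simps)
qed

lemma connected_graph_rootI:
  assumes "\<And>v. v \<in> verts G \<Longrightarrow> (r, v) \<in> (adj_rel G)\<^sup>*"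
  shows "connected_graph G"
  unfolding connected_graph_def using assms adj_rel_sym[of G] by (meson rtrancl_trans symD)

text \<open>A set closed under adjacency traps every walk that starts in it, so reachability
  survives restriction to a union of components.\<close>

lemma rtrancl_induced:
  assumes "(u, v) \<in> (adj_rel G)\<^sup>*" "u \<in> C" "\<And>x y. x \<in> C \<Longrightarrow> {x, y} \<in> edges G \<Longrightarrow> y \<in> C"
  shows "v \<in> C \<and> (u, v) \<in> (adj_rel (induced G C))\<^sup>*"
  using assms(1)
proof (induction rule: rtrancl_induct)
  case base then show ?case using assms by simp
next
  case (step y z)
  then have yz: "y \<in> C" "{y, z} \<in> edges G" by (auto simp: adj_rel_def)
  then have "z \<in> C" by (rule assms(3))
  with yz have "(y, z) \<in> adj_rel (induced G C)" by (auto simp: adj_rel_def)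
  with step \<open>z \<in> C\<close> show ?case by (auto intro: rtrancl_into_rtrancl)
qed

lemma edges_not_incident:
  assumes "finite_graph G"
  shows "edges (induced G (verts G - {v})) = edges G - {e \<in> edges G. v \<in> e}"
  using assms by (auto simp: finite_graph_def)

text \<open>The set \<open>R\<close> of roots stands in for the set of components; it makes the statement stable
  under deletion of a vertex, whose neighbours become the new roots.\<close>

lemma matching_number_rooted_bound:
  fixes k :: nat and a b :: real
  assumes ab: "a \<ge> 0" "b \<ge> 0" "(a + b) * real k = 1"
      "(real k + 1) * (1 - 2 * a - b * real k) = b * (real k - 1)" "1 - 2 * a - b * real k \<ge> 0"
    and k: "odd k"
  assumes "finite_graph G" "\<And>v. v \<in> verts G \<Longrightarrow> vdegree G v \<le> k"
    and "R \<subseteq> verts G" "\<And>v. v \<in> verts G \<Longrightarrow> \<exists>r\<in>R. (r, v) \<in> (adj_rel G)\<^sup>*"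
  shows "real (matching_number G)
    \<ge> a * real (card (verts G)) + b * real (card (edges G)) - a * real (card R)"
  using assms(7-)
proof (induction "card (verts G)" arbitrary: G R rule: less_induct)
  case less
  note G = \<open>finite_graph G\<close> and deg = less.prems(2) and R = less.prems(3,4)
  have finV: "finite (verts G)" using G by (simp add: finite_graph_def)
  have finR: "finite R" using R(1) finV by (rule finite_subset)
  consider "verts G = {}" | "verts G \<noteq> {}" "\<not> connected_graph G"
    | v where "v \<in> verts G" "connected_graph G" "\<And>M. maximum_matching G M \<Longrightarrow> v \<in> \<Union>M"
    | "verts G \<noteq> {}" "connected_graph G"
      "\<And>v. v \<in> verts G \<Longrightarrow> \<exists>M. maximum_matching G M \<and> v \<notin> \<Union>M"
    by blast
  then show ?case
  proof cases
    case 1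
    then have "edges G = {}" "R = {}" using G R by (auto simp: finite_graph_def)
    with 1 show ?thesis by simp
  next
    case 2
    then obtain r where r: "r \<in> R" using R by auto
    \<comment> \<open>\<open>C\<close> is the component of \<open>r\<close> and is charged to
      \<open>r\<close> alone, even if it holds more roots. The rest \<open>D\<close> keeps the roots
      \<open>R \<inter> D\<close>.\<close>
    define C where "C = {v. (r, v) \<in> (adj_rel G)\<^sup>*}"
    have rC: "r \<in> C" by (simp add: C_def)
    have closed: "y \<in> C" if "x \<in> C" "{x, y} \<in> edges G" for x y
    proof -
      have "(x, y) \<in> adj_rel G" using that(2) by (simp add: adj_rel_def)
      with that(1) show ?thesis by (auto simp: C_def intro: rtrancl_into_rtrancl)
    qed
    define D where "D = verts G - C"
    have closedD: "y \<in> D" if "x \<in> D" "{x, y} \<in> edges G" for x y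
      using that closed[of y x] edge_verts[OF G that(2)] by (auto simp: insert_commute D_def)
    have CV: "C \<subseteq> verts G"
      using rtrancl_induced[of r _ G "verts G"] R r edge_verts[OF G] unfolding C_def by blast
    have CV': "C \<noteq> verts G"
    proof
      assume C: "C = verts G"
      then have "connected_graph G" by (intro connected_graph_rootI[of _ r]) (auto simp: C_def)
      with 2 show False by simp
    qed
    have V: "verts G = C \<union> D" "C \<inter> D = {}" "D \<subseteq> verts G" using CV by (auto simp: D_def)
    have finCD: "finite C" "finite D" using V finV by auto
    have card_less: "card C < card (verts G)" "card D < card (verts G)"
      using CV CV' rC finV by (auto intro!: psubset_card_mono simp: D_def)
    have IHC: "real (matching_number (induced G C))
        \<ge> a * real (card (verts (induced G C))) + b * real (card (edges (induced G C)))
          - a * real (card {r})"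
    proof (rule less.hyps)
      fix v assume "v \<in> verts (induced G C)"
      then have v: "v \<in> C" by simp
      then have "(r, v) \<in> (adj_rel G)\<^sup>*" by (simp add: C_def)
      from rtrancl_induced[OF this rC] closed
      show "\<exists>r'\<in>{r}. (r', v) \<in> (adj_rel (induced G C))\<^sup>*" by blast
      show "vdegree (induced G C) v \<le> k"
        using v CV deg vdegree_induced_le[OF G] by (meson order_trans subsetD)
    qed (use card_less rC finite_graph_induced[OF G CV] in simp_all)
    have IHD: "real (matching_number (induced G D))
        \<ge> a * real (card (verts (induced G D))) + b * real (card (edges (induced G D)))
          - a * real (card (R \<inter> D))"
    proof (rule less.hyps)
      fix v assume "v \<in> verts (induced G D)"
      then have v: "v \<in> D" by simp
      then obtain r' where r': "r' \<in> R" "(r', v) \<in> (adj_rel G)\<^sup>*" using R(2) V(3) by blast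
      have r'D: "r' \<in> D"
        using r' R(1) v rtrancl_trans[of r r' "adj_rel G" v] unfolding D_def C_def by blast
      show "\<exists>r'\<in>R \<inter> D. (r', v) \<in> (adj_rel (induced G D))\<^sup>*"
        using rtrancl_induced[OF r'(2) r'D] closedD r'(1) r'D by blast
      show "vdegree (induced G D) v \<le> k"
        using v V deg vdegree_induced_le[OF G] by (meson order_trans subsetD)
    qed (use card_less finite_graph_induced[OF G V(3)] in simp_all)
    have E: "edges G = edges (induced G C) \<union> edges (induced G D)"
    proof -
      have "e \<subseteq> C \<or> e \<subseteq> D" if e: "e \<in> edges G" for e
      proof -
        obtain x y where "e = {x, y}" using G e by (auto simp: finite_graph_def card_2_iff)
        then show ?thesis using e closed[of x y] closedD[of x y] edge_verts[OF G, of x y] V by auto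
      qed
      then show ?thesis by auto
    qed
    have "edges (induced G C) \<inter> edges (induced G D) = {}"
    proof -
      have "e \<noteq> {}" if "e \<in> edges G" for e using that G by (auto simp: finite_graph_def)
      then show ?thesis using V(2) by fastforce
    qed
    then have m: "card (edges G) = card (edges (induced G C)) + card (edges (induced G D))"
      unfolding E using finite_edges[OF G] by (intro card_Un_disjoint) auto
    have n: "card (verts G) = card C + card D"
      unfolding V(1) using V finCD by (intro card_Un_disjoint) auto
    \<comment> \<open>As \<open>r\<close> is not in \<open>D\<close>, the root counts of the two
      parts add up to at most \<open>card R\<close>.\<close>
    have "card (R \<inter> D) < card R"
      using r rC finR V by (intro psubset_card_mono) auto
    then have "a * (1 + real (card (R \<inter> D))) \<le> a * real (card R)"
      using ab by (intro mult_left_mono) auto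
    moreover have "real (matching_number G)
        \<ge> real (matching_number (induced G C)) + real (matching_number (induced G D))"
      using matching_number_superadditive[OF G CV V(3,2)] by linarith
    ultimately show ?thesis using IHC IHD unfolding m n by (simp add: algebra_simps)
  next
    case 3
    define H where "H = induced G (verts G - {v})"
    define N where "N = {u. {v, u} \<in> edges G}"
    have N: "N \<subseteq> verts G - {v}" using edge_verts[OF G, of v] edge_verts(3)[OF G, of v v] by (auto simp: N_def)
    \<comment> \<open>After its last visit to \<open>v\<close> a walk continues from a neighbour of
      \<open>v\<close> and stays inside \<open>H\<close>.\<close>
    have reach: "u = v \<or> (\<exists>r\<in>N. (r, u) \<in> (adj_rel H)\<^sup>*)" if "(v, u) \<in> (adj_rel G)\<^sup>*" for u
      using that
    proof (induction rule: rtrancl_induct)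
      case (step y z)
      then have yz: "{y, z} \<in> edges G" by (simp add: adj_rel_def)
      show ?case
      proof (cases "y = v \<or> z = v")
        case True
        then show ?thesis using yz by (auto simp: N_def)
      next
        case False
        then have "(y, z) \<in> adj_rel H"
          using yz edge_verts[OF G yz] by (auto simp: adj_rel_def H_def)
        with False step.IH show ?thesis by (auto intro: rtrancl_into_rtrancl)
      qed
    qed simp
    have "card (verts G - {v}) < card (verts G)" using card_Diff1_less[OF finV 3(1)] .
    then have IH: "real (matching_number H)
        \<ge> a * real (card (verts H)) + b * real (card (edges H)) - a * real (card N)"
    proof (intro less.hyps)
      fix u assume "u \<in> verts H"
      then have u: "u \<in> verts G" "u \<noteq> v" by (auto simp: H_def)
      then have "(v, u) \<in> (adj_rel G)\<^sup>*" using 3(1,2) by (simp add: connected_graph_def)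
      then show "\<exists>r\<in>N. (r, u) \<in> (adj_rel H)\<^sup>*" using reach u by blast
      show "vdegree H u \<le> k"
        using deg[OF u(1)] vdegree_induced_le[OF G] unfolding H_def by (meson order_trans)
    qed (use N finite_graph_induced[OF G, of "verts G - {v}"] in \<open>simp_all add: H_def\<close>)
    have d: "card N = vdegree G v" by (simp add: N_def vdegree_eq_card_neighbours[OF G])
    have "vdegree G v \<le> card (edges G)"
      unfolding vdegree_def using finite_edges[OF G] by (intro card_mono) auto
    moreover have "card (edges H) = card (edges G) - vdegree G v"
      unfolding H_def edges_not_incident[OF G] vdegree_def
      using finite_edges[OF G] by (intro card_Diff_subset) auto
    ultimately have m: "real (card (edges H)) = real (card (edges G)) - real (vdegree G v)" by simp
    have "card (verts G) > 0" using 3 finV by (auto simp: card_gt_0_iff)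
    then have n: "real (card (verts H)) = real (card (verts G)) - 1"
      using 3 by (simp add: H_def)
    \<comment> \<open>The unit of matching number pays for the lost edges and for the new roots; the
      lost vertex is paid for by one old root.\<close>
    have "(a + b) * real (vdegree G v) \<le> (a + b) * real k"
      using ab deg[OF 3(1)] by (intro mult_left_mono) auto
    then have *: "a * real (vdegree G v) + b * real (vdegree G v) \<le> 1" using ab by (simp add: algebra_simps)
    have "R \<noteq> {}" using R 3 by auto
    then have "card R \<ge> 1" using finR by (simp add: Suc_leI card_gt_0_iff)
    then have "a * 1 \<le> a * real (card R)" using ab by (intro mult_left_mono) auto
    moreover have "real (matching_number G) \<ge> real (matching_number H) + 1"
      using matching_number_delete_essential[OF G 3(3)] unfolding H_def by simp
    ultimately show ?thesis using IH * unfolding m n d by (simp add: algebra_simps)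
  next
    case 4
    then have n: "card (verts G) = 2 * matching_number G + 1" using gallai_lemma[OF G] by blast
    have "2 * card (edges G) \<le> (\<Sum>v\<in>verts G. k)" "2 * card (edges G) \<le> (\<Sum>v\<in>verts G. card (verts G) - 1)"
      unfolding handshake[OF G, symmetric] using deg vdegree_less_order[OF G] by (intro sum_mono; simp)+
    then have "real (matching_number G) \<ge> a * (2 * real (matching_number G)) + b * real (card (edges G))"
      using n by (intro factor_critical_bound[OF ab(2,4,5) k]) simp_all
    moreover have "R \<noteq> {}" using R 4 by auto
    then have "card R \<ge> 1" using finR by (simp add: Suc_leI card_gt_0_iff)
    then have "a * 1 \<le> a * real (card R)" using ab by (intro mult_left_mono) auto
    ultimately show ?thesis unfolding n by (simp add: algebra_simps)
  qed
qed

text \<open>In a connected graph a single root suffices, whence the constant term of the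
  bound.\<close>

theorem matching_number_lower_bound:
  assumes k: "k \<ge> 3" "odd k"
    and G: "simple_graph G" "connected_graph G" "\<And>v. v \<in> verts G \<Longrightarrow> vdegree G v \<le> k"
  shows "real (matching_number G) \<ge> matching_bound k (card (verts G)) (card (edges G))"
proof -
  have G': "finite_graph G" using G by (simp add: simple_graph_def finite_graph_def)
  obtain r where r: "r \<in> verts G" using G by (auto simp: simple_graph_def)
  have k3: "real k \<ge> 3" using k by simp
  show ?thesis
    unfolding matching_bound_def
    using matching_number_rooted_bound[OF coefficients[OF k3] k(2) G' G(3), of "{r}"] r G(2)
    by (auto simp: connected_graph_def)
qed

section \<open>Separators and infinite families\<close>

text \<open>The easy half of the Tutte-Berge formula, with \<open>c\<close> constant on the
  components of the graph without \<open>S\<close>. Edges of a matching that meet \<open>S\<close>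
  have distinct ends there; every other edge lies inside one class of \<open>c\<close>, and a class
  holds at most half as many edges as vertices.\<close>

lemma matching_number_le_separator:
  assumes G: "finite_graph G" and S: "finite S" and I: "finite I" "c ` (verts G - S) \<subseteq> I"
    and sep: "\<And>u v. {u, v} \<in> edges G \<Longrightarrow> u \<notin> S \<Longrightarrow> v \<notin> S \<Longrightarrow> c u = c v"
  shows "matching_number G \<le> card S + (\<Sum>i\<in>I. card {v \<in> verts G - S. c v = i} div 2)"
proof (rule matching_number_le[OF G])
  fix M assume M: "is_matching G M"
  define A where "A i = {v \<in> verts G - S. c v = i}" for i
  define M1 where "M1 = {e \<in> M. e \<inter> S \<noteq> {}}"
  define M2 where "M2 i = {e \<in> M. e \<subseteq> A i}" for i
  have finM: "finite M" using finite_matching[OF G M] .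
  have "\<forall>e\<in>M1. \<exists>v. v \<in> e \<inter> S" by (auto simp: M1_def)
  then obtain g where g: "\<And>e. e \<in> M1 \<Longrightarrow> g e \<in> e \<inter> S" by metis
  have "inj_on g M1"
  proof (rule inj_onI)
    fix e f assume "e \<in> M1" "f \<in> M1" "g e = g f"
    then show "e = f" using g[of e] g[of f] matching_unique[OF M, of e f "g e"] by (auto simp: M1_def)
  qed
  then have c1: "card M1 \<le> card S" using g S by (intro card_inj_on_le[of g]) auto
  have c2: "card (M2 i) \<le> card (A i) div 2" for i
  proof -
    have "is_matching G (M2 i)"
      using M unfolding is_matching_def M2_def by (auto simp: pairwise_def)
    then have "2 * card (M2 i) = card (\<Union>(M2 i))" using card_matched[OF G] by simp
    also have "\<dots> \<le> card (A i)"
      using G by (intro card_mono) (auto simp: A_def M2_def finite_graph_def)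
    finally show ?thesis by simp
  qed
  have "M \<subseteq> M1 \<union> (\<Union>i\<in>I. M2 i)"
  proof
    fix e assume e: "e \<in> M"
    then have eG: "e \<in> edges G" "e \<subseteq> verts G" using M G by (auto simp: is_matching_def finite_graph_def)
    show "e \<in> M1 \<union> (\<Union>i\<in>I. M2 i)"
    proof (cases "e \<inter> S = {}")
      case True
      obtain x y where xy: "e = {x, y}" using eG(1) G by (auto simp: finite_graph_def card_2_iff)
      have "c x = c y" using sep[of x y] True eG xy by auto
      then have "e \<in> M2 (c x)" using e eG True xy by (auto simp: M2_def A_def)
      moreover have "c x \<in> I" using I(2) eG(2) True xy by auto
      ultimately show ?thesis by blast
    qed (use e in \<open>simp add: M1_def\<close>)
  qed
  then have "card M \<le> card (M1 \<union> (\<Union>i\<in>I. M2 i))"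
    using finM I by (intro card_mono) (auto simp: M1_def M2_def)
  also have "\<dots> \<le> card M1 + (\<Sum>i\<in>I. card (M2 i))"
    using card_Un_le[of M1 "\<Union>i\<in>I. M2 i"] card_UN_le[OF I(1), of M2] by linarith
  also have "\<dots> \<le> card S + (\<Sum>i\<in>I. card (A i) div 2)"
    using c1 c2 by (intro add_mono sum_mono) auto
  finally show "card M \<le> card S + (\<Sum>i\<in>I. card {v \<in> verts G - S. c v = i} div 2)"
    by (simp add: A_def)
qed

text \<open>Isomorphic graphs have equal order, so an injective order makes the family both infinite
  and pairwise non-isomorphic.\<close>

lemma infinitely_many_graphsI:
  assumes "\<And>p. P (F p)" "inj (\<lambda>p::nat. card (verts (F p)))"
  shows "infinitely_many_graphs P"
proof -
  have inj: "p = q" if "card (verts (F p)) = card (verts (F q))" for p q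
    using injD[OF assms(2)] that by blast
  then have "inj F" by (metis injI)
  then have "infinite (range F)" using finite_imageD[of F UNIV] by auto
  moreover have "pairwise (\<lambda>G H. \<not> isomorphic G H) (range F)"
  proof (rule pairwiseI)
    fix G H assume "G \<in> range F" "H \<in> range F" "G \<noteq> H"
    then obtain p q where "G = F p" "H = F q" "p \<noteq> q" by auto
    then show "\<not> isomorphic G H"
      using inj[of p q] bij_betw_same_card unfolding isomorphic_def by metis
  qed
  ultimately show ?thesis
    unfolding infinitely_many_graphs_def using assms(1) by (intro exI[of _ "range F"]) auto
qed

section \<open>Extremal trees\<close>

text \<open>When \<open>f v < v\<close> for positive \<open>v\<close>, this is the tree with root 0
  in which \<open>f\<close> gives the parent.\<close>

definition parent_graph :: "(nat \<Rightarrow> nat) \<Rightarrow> nat \<Rightarrow> nat ugraph" where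
  "parent_graph f N = \<lparr>verts = {..N}, edges = (\<lambda>v. {v, f v}) ` {1..N}\<rparr>"

lemma parent_graph_edge:
  assumes "\<And>v. 0 < v \<Longrightarrow> f v < v"
  shows "{u, v} \<in> edges (parent_graph f N) \<longleftrightarrow>
    (0 < u \<and> u \<le> N \<and> v = f u) \<or> (0 < v \<and> v \<le> N \<and> u = f v)"
  unfolding parent_graph_def by (auto simp: doubleton_eq_iff image_iff Suc_le_eq)

text \<open>Each edge determines its child, the larger end.\<close>

lemma card_edges_parent_graph:
  assumes f: "\<And>v. 0 < v \<Longrightarrow> f v < v"
  shows "card (edges (parent_graph f N)) = N"
proof -
  have "inj_on (\<lambda>v. {v, f v}) {1..N}"
  proof (rule inj_onI)
    fix u v assume "u \<in> {1..N}" "v \<in> {1..N}" "{u, f u} = {v, f v}"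
    then show "u = v" using f[of u] f[of v] by (auto simp: doubleton_eq_iff)
  qed
  then show ?thesis by (simp add: parent_graph_def card_image)
qed

text \<open>The largest vertex of a cycle would have two distinct smaller neighbours, but its only
  smaller neighbour is its parent.\<close>

lemma tree_parent_graph:
  assumes f: "\<And>v. 0 < v \<Longrightarrow> f v < v"
  shows "tree (parent_graph f N)"
proof -
  let ?G = "parent_graph f N"
  have "simple_graph ?G"
  proof -
    have "f v \<le> N \<and> card {v, f v} = 2" if "v \<in> {1..N}" for v using f[of v] that by auto
    then show ?thesis by (auto simp: simple_graph_def parent_graph_def)
  qed
  moreover have "connected_graph ?G"
  proof (rule connected_graph_rootI)
    fix v assume "v \<in> verts ?G"
    then have "v \<le> N" by (simp add: parent_graph_def)
    then show "(0, v) \<in> (adj_rel ?G)\<^sup>*"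
    proof (induction v rule: less_induct)
      case (less v)
      show ?case
      proof (cases "v = 0")
        case False
        then have "(0, f v) \<in> (adj_rel ?G)\<^sup>*" using less f[of v] by simp
        moreover have "(f v, v) \<in> adj_rel ?G"
          using False less.prems by (simp add: adj_rel_def parent_graph_edge[OF f])
        ultimately show ?thesis by (rule rtrancl_into_rtrancl)
      qed simp
    qed
  qed
  moreover have False if "is_cycle ?G c" for c
  proof -
    define n where "n = length c"
    have c: "3 \<le> n" "distinct c" and E: "\<And>i. i < n \<Longrightarrow> {c ! i, c ! (Suc i mod n)} \<in> edges ?G"
      using that by (auto simp: is_cycle_def n_def)
    have "set c \<noteq> {}" using c by (auto simp: n_def)
    then have "Max (set c) \<in> set c" by (intro Max_in) auto
    then obtain i where i: "i < n" "c ! i = Max (set c)" by (auto simp: in_set_conv_nth n_def)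
    have small: "c ! l = f (c ! i)" if "l < n" "{c ! i, c ! l} \<in> edges ?G" for l
    proof -
      have "c ! l \<le> c ! i" using that(1) i by (simp add: n_def)
      then show ?thesis
        using that(2) f[of "c ! l"] by (auto simp: parent_graph_edge[OF f])
    qed
    \<comment> \<open>\<open>j\<close> is the cyclic predecessor of \<open>i\<close>; in a cycle of
      length at least 3 it differs from the successor.\<close>
    define j where "j = (if i = 0 then n - 1 else i - 1)"
    have j: "j < n" "Suc j mod n = i" using i c by (auto simp: j_def)
    have s: "Suc i mod n < n" using c by simp
    have "c ! j = c ! (Suc i mod n)"
      using small[OF s E[OF i(1)]] small[OF j(1)] E[OF j(1)] j(2) by (simp add: insert_commute)
    then have "j = Suc i mod n" using c(2) j s by (simp add: nth_eq_iff_index_eq n_def)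
    moreover have "Suc i mod n = (if Suc i = n then 0 else Suc i)" using i by simp
    ultimately show False using c i unfolding j_def by (auto split: if_splits)
  qed
  ultimately show ?thesis unfolding tree_def by blast
qed

text \<open>The centres, congruent to 1 modulo \<open>k\<close>, have degree \<open>k\<close>, and the last leaf of each star is
  a neighbour of the next centre.\<close>

definition caterpillar_parent :: "nat \<Rightarrow> nat \<Rightarrow> nat" where
  "caterpillar_parent k v = (if v mod k = 1 then v - 1 else k * ((v - 1) div k) + 1)"

lemma caterpillar_parent_less:
  assumes "k \<ge> 3" "0 < v" shows "caterpillar_parent k v < v"
proof (cases "v mod k = 1")
  case False
  have "(v - 1) mod k \<noteq> 0"
  proof
    assume "(v - 1) mod k = 0"
    then have "Suc (v - 1) mod k = 1" unfolding mod_Suc using assms by simp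
    with False assms show False by simp
  qed
  moreover have "v - 1 = k * ((v - 1) div k) + (v - 1) mod k" by simp
  ultimately have "k * ((v - 1) div k) + 1 < v" using assms(2) by linarith
  then show ?thesis using False by (simp add: caterpillar_parent_def)
qed (use assms in \<open>simp add: caterpillar_parent_def\<close>)

text \<open>Thus every edge has a centre among its ends: the child, or else the parent.\<close>

lemma caterpillar_parent_centre:
  assumes "k \<ge> 3" "v mod k \<noteq> 1" shows "caterpillar_parent k v mod k = 1"
  using assms by (simp add: caterpillar_parent_def mod_Suc)

text \<open>A centre \<open>v\<close> sees \<open>v - 1\<close> and its children, which lie among
  the \<open>k - 1\<close> vertices after it; any other vertex sees at most two centres.\<close>

lemma caterpillar_degree:
  assumes k: "k \<ge> 3"
  shows "vdegree (parent_graph (caterpillar_parent k) N) v \<le> k"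
proof -
  let ?f = "caterpillar_parent k" let ?G = "parent_graph ?f N"
  note edge = parent_graph_edge[OF caterpillar_parent_less[OF k]]
  have G: "finite_graph ?G"
    using tree_parent_graph[OF caterpillar_parent_less[OF k], of N]
    by (simp add: tree_def simple_graph_def finite_graph_def)
  have next_centre: "u = v + 1" if "u mod k = 1" "0 < u" "v = ?f u" for u
    using that by (simp add: caterpillar_parent_def)
  show ?thesis
  proof (cases "v mod k = 1")
    case True
    then have v: "0 < v" "?f v = v - 1" by (auto simp: caterpillar_parent_def intro: Nat.gr0I)
    have "{u. {v, u} \<in> edges ?G} \<subseteq> insert (v - 1) {v + 1..<v + k}"
    proof
      fix u assume "u \<in> {u. {v, u} \<in> edges ?G}"
      then consider "u = v - 1" | "0 < u" "v = ?f u" using v by (auto simp: edge)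
      then show "u \<in> insert (v - 1) {v + 1..<v + k}"
      proof cases
        case 2
        have "u mod k \<noteq> 1"
          using next_centre[OF _ 2] True k by (auto simp: mod_Suc split: if_splits)
        then have "v = k * ((u - 1) div k) + 1" using 2 by (simp add: caterpillar_parent_def)
        moreover have "u - 1 = k * ((u - 1) div k) + (u - 1) mod k" by simp
        moreover have "(u - 1) mod k < k" using k by simp
        ultimately have "u < v + k" using 2 by linarith
        then show ?thesis using 2 caterpillar_parent_less[OF k 2(1)] by simp
      qed simp
    qed
    then have "card {u. {v, u} \<in> edges ?G} \<le> card (insert (v - 1) {v + 1..<v + k})"
      by (intro card_mono) auto
    also have "\<dots> \<le> k" using k by (simp add: card_insert_if)
    finally show ?thesis by (simp add: vdegree_eq_card_neighbours[OF G])
  next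
    case False
    \<comment> \<open>For the root 0 the value \<open>?f 0\<close> is not a parent, but it is 1,
      which is \<open>v + 1\<close>.\<close>
    have "{u. {v, u} \<in> edges ?G} \<subseteq> {?f v, v + 1}"
    proof
      fix u assume "u \<in> {u. {v, u} \<in> edges ?G}"
      then consider "u = ?f v" | "0 < u" "v = ?f u" by (auto simp: edge)
      then show "u \<in> {?f v, v + 1}"
      proof cases
        case 2
        then have "u mod k = 1" using caterpillar_parent_centre[OF k, of u] False by auto
        with next_centre 2 show ?thesis by simp
      qed simp
    qed
    then have "card {u. {v, u} \<in> edges ?G} \<le> card {?f v, v + 1}" by (intro card_mono) auto
    also have "\<dots> \<le> 2" by (simp add: card_insert_if)
    finally show ?thesis using k by (simp add: vdegree_eq_card_neighbours[OF G])
  qed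
qed

text \<open>The \<open>p\<close> centres form a vertex cover. With \<open>id\<close> as labelling
  the remaining classes have at most one vertex and contribute 0.\<close>

lemma caterpillar_matching_number_le:
  assumes k: "k \<ge> 3"
  shows "matching_number (parent_graph (caterpillar_parent k) (k * p)) \<le> p"
proof -
  let ?f = "caterpillar_parent k" let ?G = "parent_graph ?f (k * p)"
  define S where "S = (\<lambda>i. k * i + 1) ` {..<p}"
  note edge = parent_graph_edge[OF caterpillar_parent_less[OF k]]
  have G: "finite_graph ?G"
    using tree_parent_graph[OF caterpillar_parent_less[OF k]]
    by (simp add: tree_def simple_graph_def finite_graph_def)
  have S: "v \<in> S" if "v mod k = 1" "v \<le> k * p" for v
  proof -
    have v: "v = k * (v div k) + 1" using that(1) by (metis mult_div_mod_eq)
    then have "k * (v div k) < k * p" using that(2) by linarith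
    then have "v div k < p" by simp
    with v show ?thesis unfolding S_def by blast
  qed
  have cover: "u \<in> S" if u: "0 < u" "u \<le> k * p" "?f u \<notin> S" for u
  proof (rule ccontr)
    assume "u \<notin> S"
    then have "u mod k \<noteq> 1" using S u by blast
    then have "?f u mod k = 1" by (rule caterpillar_parent_centre[OF k])
    then show False using S[of "?f u"] u caterpillar_parent_less[OF k u(1)] by simp
  qed
  have "matching_number ?G \<le> card S + (\<Sum>i\<in>verts ?G. card {v \<in> verts ?G - S. id v = i} div 2)"
  proof (rule matching_number_le_separator[OF G])
    fix u v assume "{u, v} \<in> edges ?G" "u \<notin> S" "v \<notin> S"
    then show "id u = id v" using cover by (auto simp: edge)
  qed (auto simp: S_def parent_graph_def)
  also have "(\<Sum>i\<in>verts ?G. card {v \<in> verts ?G - S. id v = i} div 2) = 0"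
  proof (rule sum.neutral, rule ballI)
    fix i
    have "card {v \<in> verts ?G - S. id v = i} \<le> card {i}" by (intro card_mono) auto
    then show "card {v \<in> verts ?G - S. id v = i} div 2 = 0" by simp
  qed
  also have "card S \<le> p" unfolding S_def using card_image_le[of "{..<p}"] by simp
  finally show ?thesis by simp
qed

lemma infinitely_many_extremal_trees:
  assumes k: "k \<ge> 3" "odd k"
  shows "infinitely_many_graphs (\<lambda>T. tree T \<and> max_degree T \<le> k \<and>
    real (matching_number T) = matching_bound k (card (verts T)) (card (edges T)))"
proof (rule infinitely_many_graphsI)
  fix p
  let ?T = "parent_graph (caterpillar_parent k) (k * p)"
  have T: "tree ?T" by (rule tree_parent_graph[OF caterpillar_parent_less[OF k(1)]])
  have n: "card (verts ?T) = k * p + 1" by (simp add: parent_graph_def)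
  have m: "card (edges ?T) = k * p" by (rule card_edges_parent_graph[OF caterpillar_parent_less[OF k(1)]])
  define a where "a = (real k - 1) / (real k * ((real k)\<^sup>2 - 3))"
  define b where "b = ((real k)\<^sup>2 - real k - 2) / (real k * ((real k)\<^sup>2 - 3))"
  have ab: "(a + b) * real k = 1" using coefficients(3)[of "real k"] k by (simp add: a_def b_def)
  \<comment> \<open>The size is one less than the order, so the constant term cancels one
    vertex.\<close>
  have "matching_bound k (k * p + 1) (k * p) = ((a + b) * real k) * real p"
    unfolding matching_bound_def a_def[symmetric] b_def[symmetric] by (simp add: algebra_simps)
  then have bound: "matching_bound k (k * p + 1) (k * p) = real p" unfolding ab by simp
  have "real (matching_number ?T) \<ge> matching_bound k (card (verts ?T)) (card (edges ?T))"
    using T caterpillar_degree[OF k(1)] by (intro matching_number_lower_bound k) (auto simp: tree_def)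
  then have "real (matching_number ?T) = matching_bound k (card (verts ?T)) (card (edges ?T))"
    using caterpillar_matching_number_le[OF k(1), of p] unfolding n m bound by linarith
  moreover have "max_degree ?T \<le> k"
    unfolding max_degree_def using caterpillar_degree[OF k(1)]
    by (subst Max_le_iff) (auto simp: parent_graph_def)
  ultimately show "tree ?T \<and> max_degree ?T \<le> k \<and>
      real (matching_number ?T) = matching_bound k (card (verts ?T)) (card (edges ?T))"
    using T by blast
next
  show "inj (\<lambda>p. card (verts (parent_graph (caterpillar_parent k) (k * p))))"
    using k by (auto simp: inj_def parent_graph_def)
qed

section \<open>Extremal regular graphs\<close>

text \<open>The regular witnesses are easiest to name over a datatype; an injective renaming carries
  them to \<open>nat\<close>.\<close>

definition image_graph :: "('a \<Rightarrow> 'b) \<Rightarrow> 'a ugraph \<Rightarrow> 'b ugraph" where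
  "image_graph f G = \<lparr>verts = f ` verts G, edges = (`) f ` edges G\<rparr>"

lemma image_graph_simps [simp]:
  "verts (image_graph f G) = f ` verts G" "edges (image_graph f G) = (`) f ` edges G"
  by (simp_all add: image_graph_def)

context
  fixes f :: "'a \<Rightarrow> 'b"
  assumes f: "inj f"
begin

lemma inj_image_edges: "inj ((`) f)"
  using f by (simp add: inj_def inj_image_eq_iff)

lemma simple_image_graph: "simple_graph G \<Longrightarrow> simple_graph (image_graph f G)"
  using f by (auto simp: simple_graph_def card_image inj_on_subset)

lemma connected_image_graph:
  assumes "connected_graph G" shows "connected_graph (image_graph f G)"
proof -
  have "(f u, f v) \<in> (adj_rel (image_graph f G))\<^sup>*" if "(u, v) \<in> (adj_rel G)\<^sup>*" for u v
    using that
  proof (induction rule: rtrancl_induct)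
    case (step y z)
    then have "f ` {y, z} \<in> (`) f ` edges G" by (auto simp: adj_rel_def simp del: image_insert)
    then have "(f y, f z) \<in> adj_rel (image_graph f G)" by (simp add: adj_rel_def)
    with step.IH show ?case by (rule rtrancl_into_rtrancl)
  qed simp
  then show ?thesis using assms by (auto simp: connected_graph_def)
qed

lemma vdegree_image_graph: "vdegree (image_graph f G) (f v) = vdegree G v"
proof -
  have "{e \<in> edges (image_graph f G). f v \<in> e} = (`) f ` {e \<in> edges G. v \<in> e}"
  proof -
    have "{e \<in> edges (image_graph f G). f v \<in> e} = (`) f ` {e \<in> edges G. f v \<in> f ` e}"
      by (simp only: image_graph_simps) blast
    then show ?thesis by (simp only: inj_image_mem_iff[OF f])
  qed
  then show ?thesis
    unfolding vdegree_def using inj_image_edges by (simp add: card_image inj_on_subset)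
qed

lemma matching_number_image_graph: "matching_number (image_graph f G) = matching_number G"
proof -
  have inj: "inj_on ((`) f) A" for A using inj_image_edges by (rule inj_on_subset) simp
  have disj: "disjnt (f ` A) (f ` B) \<longleftrightarrow> disjnt A B" for A B
    using f by (auto simp: disjnt_def inj_def)
  have pw: "pairwise disjnt ((`) f ` M) \<longleftrightarrow> pairwise disjnt M" for M
    unfolding pairwise_image using f by (auto simp: pairwise_def disj inj_image_eq_iff)
  have "{card M | M. is_matching (image_graph f G) M} = {card M | M. is_matching G M}"
  proof (intro equalityI subsetI)
    fix c assume "c \<in> {card M | M. is_matching (image_graph f G) M}"
    then obtain M where M: "c = card M" "is_matching (image_graph f G) M" by auto
    then obtain N where "N \<subseteq> edges G" "M = (`) f ` N" by (auto simp: is_matching_def subset_image_iff)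
    with M show "c \<in> {card M | M. is_matching G M}"
      by (auto simp: is_matching_def pw card_image[OF inj])
  next
    fix c assume "c \<in> {card M | M. is_matching G M}"
    then obtain M where M: "c = card M" "is_matching G M" by auto
    then have "is_matching (image_graph f G) ((`) f ` M)" by (auto simp: is_matching_def pw)
    moreover have "c = card ((`) f ` M)" using M card_image[OF inj] by simp
    ultimately show "c \<in> {card M | M. is_matching (image_graph f G) M}" by blast
  qed
  then show ?thesis by (simp add: matching_number_def)
qed

lemma card_image_graph:
  "card (verts (image_graph f G)) = card (verts G)" "card (edges (image_graph f G)) = card (edges G)"
  using f inj_image_edges by (simp_all add: card_image inj_on_subset)

end

declare One_nat_def [simp del]

text \<open>Prescribing neighbour sets reduces each degree to a cardinality, at the price of one
  symmetry check.\<close>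

definition neighbour_graph :: "'a set \<Rightarrow> ('a \<Rightarrow> 'a set) \<Rightarrow> 'a ugraph" where
  "neighbour_graph V nb = \<lparr>verts = V, edges = {{u, v} | u v. u \<in> V \<and> v \<in> nb u}\<rparr>"

text \<open>Stems form the separator, links are the single vertices left by it, and
  \<open>Gadget j l x\<close> is vertex \<open>x\<close> of the gadget in slot \<open>l\<close> of
  stem \<open>j\<close>.\<close>

datatype vertex = Stem nat | Link nat | Gadget nat nat nat

instance vertex :: countable
  by countable_datatype

text \<open>A stem \<open>Stem j\<close> has slots \<open>0, ..., k - 1\<close>; slot 0 holds the link to the following block of
  \<open>k - 1\<close> stems and slot 1 the link to the preceding one, where they exist, and every other slot
  \<open>l\<close> the vertex 0 of a gadget on \<open>k + 2\<close> vertices.\<close>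

definition slot :: "nat \<Rightarrow> nat \<Rightarrow> nat \<Rightarrow> nat \<Rightarrow> vertex" where
  "slot k p j l =
    (if l = 0 \<and> j < (k - 1) * p then Link (j div (k - 1))
     else if l = 1 \<and> 0 < j \<and> (k - 1) dvd j then Link (j div (k - 1) - 1)
     else Gadget j l 0)"

definition gadget_slots :: "nat \<Rightarrow> nat \<Rightarrow> (nat \<times> nat) set" where
  "gadget_slots k p = {(j, l). j \<le> (k - 1) * p \<and> l < k \<and> slot k p j l = Gadget j l 0}"

text \<open>The complement of a gadget is the path \<open>1, 0, 2\<close> together with a perfect matching
  \<open>{3, 4}, {5, 6}, ..., {k, k + 1}\<close>, so vertex 0 has degree \<open>k - 1\<close> and all others degree \<open>k\<close>.\<close>

definition gadget_adj :: "nat \<Rightarrow> nat \<Rightarrow> bool" where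
  "gadget_adj x y \<longleftrightarrow> x \<noteq> y \<and> \<not> (x = 0 \<and> y \<in> {1, 2}) \<and> \<not> (y = 0 \<and> x \<in> {1, 2}) \<and>
     \<not> (3 \<le> x \<and> 3 \<le> y \<and> (x - 1) div 2 = (y - 1) div 2)"

text \<open>The closed range gives a link \<open>k\<close> stems; consecutive links share one stem,
  whose slots 0 and 1 they occupy.\<close>

fun nbs :: "nat \<Rightarrow> nat \<Rightarrow> vertex \<Rightarrow> vertex set" where
  "nbs k p (Stem j) = slot k p j ` {..<k}"
| "nbs k p (Link i) = Stem ` {(k - 1) * i..(k - 1) * (i + 1)}"
| "nbs k p (Gadget j l x) =
    (if x = 0 then {Stem j} else {}) \<union> Gadget j l ` {y. y < k + 2 \<and> gadget_adj x y}"

definition regular_verts :: "nat \<Rightarrow> nat \<Rightarrow> vertex set" where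
  "regular_verts k p = Stem ` {..(k - 1) * p} \<union> Link ` {..<p}
     \<union> (\<lambda>((j, l), x). Gadget j l x) ` (gadget_slots k p \<times> {..<k + 2})"

definition regular_graph :: "nat \<Rightarrow> nat \<Rightarrow> vertex ugraph" where
  "regular_graph k p = neighbour_graph (regular_verts k p) (nbs k p)"

section \<open>Graphs given by neighbour sets\<close>

context
  fixes V :: "'a set" and nb :: "'a \<Rightarrow> 'a set"
  assumes sym: "\<And>u v. u \<in> V \<Longrightarrow> v \<in> nb u \<Longrightarrow> v \<in> V \<and> u \<in> nb v \<and> u \<noteq> v"
begin

lemma neighbour_graph_edge: "{u, v} \<in> edges (neighbour_graph V nb) \<longleftrightarrow> u \<in> V \<and> v \<in> nb u"
  unfolding neighbour_graph_def using sym by (auto simp: doubleton_eq_iff)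

lemma finite_neighbour_graph: "finite V \<Longrightarrow> finite_graph (neighbour_graph V nb)"
  unfolding finite_graph_def
proof (intro conjI ballI)
  fix e assume "e \<in> edges (neighbour_graph V nb)"
  then obtain u v where e: "e = {u, v}" "u \<in> V" "v \<in> nb u" by (auto simp: neighbour_graph_def)
  with sym[OF e(2,3)] show "e \<subseteq> verts (neighbour_graph V nb)" "card e = 2"
    by (simp_all add: neighbour_graph_def)
qed (simp add: neighbour_graph_def)

lemma vdegree_neighbour_graph:
  "finite V \<Longrightarrow> v \<in> V \<Longrightarrow> vdegree (neighbour_graph V nb) v = card (nb v)"
  unfolding vdegree_eq_card_neighbours[OF finite_neighbour_graph] neighbour_graph_edge by simp

end

lemma less_mult_div_add_1: "j < w * (j div w + 1)" if "0 < w" for j w :: nat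
  using dividend_less_times_div[OF that, of j] by (simp add: distrib_left)

lemma regular_verts_simps [simp]:
  "Stem j \<in> regular_verts k p \<longleftrightarrow> j \<le> (k - 1) * p"
  "Link i \<in> regular_verts k p \<longleftrightarrow> i < p"
  "Gadget j l x \<in> regular_verts k p \<longleftrightarrow> (j, l) \<in> gadget_slots k p \<and> x < k + 2"
  unfolding regular_verts_def by (auto simp: image_iff intro!: bexI[of _ "(j, l)"])

lemma gadget_adj_commute: "gadget_adj x y \<longleftrightarrow> gadget_adj y x"
  unfolding gadget_adj_def by auto

text \<open>In the complement vertex 0 has degree 2 and every other vertex degree 1;
  \<open>k\<close> odd lets the pairs from 3 upwards end exactly at \<open>k + 1\<close>.\<close>

lemma card_gadget_nbs:
  assumes k: "k \<ge> 3" "odd k" and x: "x < k + 2"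
  shows "card {y. y < k + 2 \<and> gadget_adj x y} = (if x = 0 then k - 1 else k)"
proof -
  consider "x = 0" | "x = 1" | "x = 2" | "x \<ge> 3" by linarith
  then show ?thesis
  proof cases
    case 1
    then have "{y. y < k + 2 \<and> gadget_adj x y} = {3..<k + 2}" by (auto simp: gadget_adj_def)
    with 1 show ?thesis by simp
  next
    case 2
    then have "{y. y < k + 2 \<and> gadget_adj x y} = {2..<k + 2}" by (auto simp: gadget_adj_def)
    with 2 show ?thesis by simp
  next
    case 3
    then have "{y. y < k + 2 \<and> gadget_adj x y} = insert 1 {3..<k + 2}"
      by (auto simp: gadget_adj_def)
    with 3 k show ?thesis by simp
  next
    case 4
    define a where "a = (x - 1) div 2"
    have a: "x = 2 * a + 1 \<or> x = 2 * a + 2" "a \<ge> 1" using 4 unfolding a_def by linarith+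
    \<comment> \<open>\<open>z\<close> is the partner of \<open>x\<close> in the pair
      \<open>2 * a + 1\<close>, \<open>2 * a + 2\<close>, whose sum is
      \<open>4 * a + 3\<close>.\<close>
    define z where "z = 4 * a + 3 - x"
    obtain b where b: "k = 2 * b + 1" using k(2) by (rule oddE)
    have "a \<le> b" using a x b by linarith
    then have z: "3 \<le> z" "z < k + 2" "z \<noteq> x" using a b unfolding z_def by auto
    have "(y - 1) div 2 = a \<longleftrightarrow> y = 2 * a + 1 \<or> y = 2 * a + 2" if "3 \<le> y" for y
      using that by auto
    then have *: "(x - 1) div 2 = (y - 1) div 2 \<longleftrightarrow> y = x \<or> y = z" if "3 \<le> y" for y
      using that a(1) unfolding z_def a_def[symmetric] by auto
    have "gadget_adj x y \<longleftrightarrow> y \<notin> {x, z}" for y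
      using 4 z(1) *[of y] unfolding gadget_adj_def by (cases "3 \<le> y") auto
    then have "{y. y < k + 2 \<and> gadget_adj x y} = {..<k + 2} - {x, z}" by auto
    with 4 x z show ?thesis by (simp add: card_Diff_subset)
  qed
qed

section \<open>The regular family: symmetry, regularity, connectedness\<close>

context
  fixes k p :: nat
  assumes k: "k \<ge> 3" "odd k"
begin

lemma slot_in_verts:
  assumes j: "j \<le> (k - 1) * p" and l: "l < k"
  shows "slot k p j l \<in> regular_verts k p \<and> Stem j \<in> nbs k p (slot k p j l)"
proof -
  consider "slot k p j l = Link (j div (k - 1))" "j < (k - 1) * p"
    | "slot k p j l = Link (j div (k - 1) - 1)" "0 < j" "(k - 1) dvd j"
    | "slot k p j l = Gadget j l 0"
    by (metis slot_def)
  then show ?thesis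
  proof cases
    case 1
    have "j div (k - 1) < p" using 1(2) k by (simp add: less_mult_imp_div_less mult.commute)
    moreover have "(k - 1) * (j div (k - 1)) \<le> j" by simp
    moreover have "j < (k - 1) * (j div (k - 1) + 1)"
      using k by (intro less_mult_div_add_1) simp
    ultimately show ?thesis using 1(1) by auto
  next
    case 2
    then obtain t where t: "j = (k - 1) * t" "t > 0" by (auto elim: dvdE)
    then have "t \<le> p" using j k by simp
    moreover have "j div (k - 1) = t" using t k by simp
    ultimately show ?thesis using 2(1) t by (auto simp: mult_le_mono)
  next
    case 3
    then show ?thesis using j l by (simp add: gadget_slots_def)
  qed
qed

lemma nbs_Link:
  assumes i: "i < p" and j: "(k - 1) * i \<le> j" "j \<le> (k - 1) * (i + 1)"
  shows "j \<le> (k - 1) * p" "Link i \<in> nbs k p (Stem j)"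
proof -
  have ip: "(k - 1) * (i + 1) \<le> (k - 1) * p" using i by (intro mult_le_mono2) simp
  then show "j \<le> (k - 1) * p" using j by linarith
  show "Link i \<in> nbs k p (Stem j)"
  \<comment> \<open>The last stem of the block holds the link in slot 1, every other one in slot
    0.\<close>
  proof (cases "j = (k - 1) * (i + 1)")
    case True
    then have "j div (k - 1) = i + 1" "0 < j" "(k - 1) dvd j"
      using k by (simp_all del: mult_Suc_right)
    then have "slot k p j 1 = Link i" by (simp add: slot_def)
    then have "Link i \<in> slot k p j ` {..<k}" using k by (intro image_eqI[of _ _ 1]) auto
    then show ?thesis by simp
  next
    case False
    then have "j < (k - 1) * (i + 1)" using j by simp
    then have "j < (k - 1) * p" using ip by (rule less_le_trans)
    moreover have "j div (k - 1) = i"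
      using \<open>j < (k - 1) * (i + 1)\<close> j(1) by (intro div_nat_eqI) (simp_all only: Suc_eq_plus1)
    ultimately have "slot k p j 0 = Link i" by (simp add: slot_def)
    then have "Link i \<in> slot k p j ` {..<k}" using k by (intro image_eqI[of _ _ 0]) auto
    then show ?thesis by simp
  qed
qed

lemma nbs_sym:
  assumes u: "u \<in> regular_verts k p" and v: "v \<in> nbs k p u"
  shows "v \<in> regular_verts k p \<and> u \<in> nbs k p v \<and> u \<noteq> v"
proof (cases u)
  case (Stem j)
  then obtain l where l: "l < k" "v = slot k p j l" using v by auto
  have "j \<le> (k - 1) * p" using u Stem by simp
  from slot_in_verts[OF this l(1)] show ?thesis
    using Stem l(2) by (simp add: slot_def)
next
  case (Link i)
  then obtain j where j: "v = Stem j" "(k - 1) * i \<le> j" "j \<le> (k - 1) * (i + 1)"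
    using v by auto
  have "i < p" using u Link by simp
  from nbs_Link[OF this j(2,3)] show ?thesis using Link j(1) by simp
next
  case (Gadget j l x)
  then have jl: "(j, l) \<in> gadget_slots k p" "x < k + 2" using u by auto
  then have s: "j \<le> (k - 1) * p" "l < k" "slot k p j l = Gadget j l 0"
    by (auto simp: gadget_slots_def)
  show ?thesis
  proof (cases "x = 0 \<and> v = Stem j")
    case True
    have "Gadget j l 0 \<in> slot k p j ` {..<k}" using s by (metis imageI lessThan_iff)
    then show ?thesis using True Gadget s by simp
  next
    case False
    then obtain y where y: "v = Gadget j l y" "y < k + 2" "gadget_adj x y"
      using v Gadget by (auto split: if_splits)
    then show ?thesis using Gadget jl gadget_adj_commute[of x y] by (auto simp: gadget_adj_def)
  qed
qed

lemma finite_gadget_slots: "finite (gadget_slots k p)"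
  by (rule finite_subset[of _ "{..(k - 1) * p} \<times> {..<k}"]) (auto simp: gadget_slots_def)

lemma finite_regular_verts: "finite (regular_verts k p)"
  unfolding regular_verts_def using finite_gadget_slots by simp

lemmas regular_graph_edge = neighbour_graph_edge[of "regular_verts k p" "nbs k p", OF nbs_sym,
    folded regular_graph_def]

lemma verts_regular_graph [simp]: "verts (regular_graph k p) = regular_verts k p"
  by (simp add: regular_graph_def neighbour_graph_def)

lemma finite_regular_graph: "finite_graph (regular_graph k p)"
  unfolding regular_graph_def by (rule finite_neighbour_graph[OF nbs_sym finite_regular_verts])

lemma simple_regular_graph: "simple_graph (regular_graph k p)"
proof -
  have "Stem 0 \<in> regular_verts k p" by simp
  then have "verts (regular_graph k p) \<noteq> {}" by (metis empty_iff verts_regular_graph)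
  then show ?thesis
    using finite_regular_graph by (simp add: simple_graph_def finite_graph_def)
qed

lemma inj_on_slot: "inj_on (slot k p j) {..<k}"
proof (rule inj_onI)
  fix l l' assume eq: "slot k p j l = slot k p j l'"
  \<comment> \<open>Only the two link slots could coincide; a positive multiple of
    \<open>k - 1\<close> has a positive quotient, so the subtraction does not truncate.\<close>
  have "j div (k - 1) \<noteq> j div (k - 1) - 1" if "0 < j" "(k - 1) dvd j"
    using that k by (auto elim!: dvdE)
  then show "l = l'"
    using eq unfolding slot_def by (simp split: if_split_asm)
qed

text \<open>Vertex 0 of a gadget is one short inside the gadget, and its stem makes up for
  it.\<close>

lemma card_nbs:
  assumes "v \<in> regular_verts k p" shows "card (nbs k p v) = k"
proof (cases v)
  case (Stem j)
  then show ?thesis by (simp add: card_image[OF inj_on_slot])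
next
  case (Link i)
  have e: "(k - 1) * (i + 1) = (k - 1) * i + (k - 1)" by (simp only: distrib_left mult_1_right)
  show ?thesis unfolding Link nbs.simps e using k by (subst card_image) (auto simp: inj_on_def)
next
  case (Gadget j l x)
  then have x: "x < k + 2" using assms by simp
  have "card (Gadget j l ` {y. y < k + 2 \<and> gadget_adj x y}) = card {y. y < k + 2 \<and> gadget_adj x y}"
    by (rule card_image) (simp add: inj_on_def)
  moreover have "Stem j \<notin> Gadget j l ` {y. y < k + 2 \<and> gadget_adj x y}" by auto
  ultimately show ?thesis using Gadget card_gadget_nbs[OF k x] k by (cases "x = 0") simp_all
qed

lemma vdegree_regular_graph: "v \<in> regular_verts k p \<Longrightarrow> vdegree (regular_graph k p) v = k"
  unfolding regular_graph_def
  using vdegree_neighbour_graph[OF nbs_sym finite_regular_verts] card_nbs by simp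

lemma connected_regular_graph: "connected_graph (regular_graph k p)"
proof (rule connected_graph_rootI)
  let ?R = "(adj_rel (regular_graph k p))\<^sup>*"
  have step: "(Stem 0, v) \<in> ?R"
    if "(Stem 0, u) \<in> ?R" "u \<in> regular_verts k p" "v \<in> nbs k p u" for u v
  proof -
    have "(u, v) \<in> adj_rel (regular_graph k p)"
      using that by (simp add: adj_rel_def regular_graph_edge)
    with that(1) show ?thesis by (rule rtrancl_into_rtrancl)
  qed
  have stem_link: "(Stem 0, Stem j) \<in> ?R \<Longrightarrow> i < p \<Longrightarrow> (k - 1) * i \<le> j \<Longrightarrow> j \<le> (k - 1) * (i + 1)
      \<Longrightarrow> (Stem 0, Link i) \<in> ?R" for i j
    using nbs_Link[of i j] step[of "Stem j" "Link i"] by simp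
  have stem: "(Stem 0, Stem j) \<in> ?R" if "j \<le> (k - 1) * p" for j
    using that
  proof (induction j rule: less_induct)
    case (less j)
    show ?case
    proof (cases "j = 0")
      case False
      \<comment> \<open>Using \<open>j - 1\<close> makes a stem on a block boundary reachable
        through the preceding link, from a smaller stem.\<close>
      define i where "i = (j - 1) div (k - 1)"
      have "j - 1 < (k - 1) * p" using less.prems False by simp
      then have i: "i < p" unfolding i_def using k by (simp add: less_mult_imp_div_less mult.commute)
      have le: "(k - 1) * i \<le> j - 1" unfolding i_def by simp
      have ge: "j - 1 < (k - 1) * (i + 1)"
        unfolding i_def using k by (intro less_mult_div_add_1) simp
      have "(Stem 0, Stem ((k - 1) * i)) \<in> ?R" using le False less by simp
      then have "(Stem 0, Link i) \<in> ?R" by (rule stem_link) (use i in simp_all)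
      then show ?thesis
      proof (rule step)
        have "(k - 1) * i \<le> j" "j \<le> (k - 1) * (i + 1)" using le ge by linarith+
        then show "Stem j \<in> nbs k p (Link i)" by simp
      qed (use i in simp)
    qed simp
  qed
  fix v assume "v \<in> verts (regular_graph k p)"
  then have v: "v \<in> regular_verts k p" by simp
  show "(Stem 0, v) \<in> ?R"
  proof (cases v)
    case (Stem j)
    then show ?thesis using v stem by simp
  next
    case (Link i)
    then have i: "i < p" using v by simp
    then have "(k - 1) * i \<le> (k - 1) * p" by simp
    then have "(Stem 0, Stem ((k - 1) * i)) \<in> ?R" by (rule stem)
    then show ?thesis unfolding Link by (rule stem_link) (use i in simp_all)
  next
    case (Gadget j l x)
    then have jl: "(j, l) \<in> gadget_slots k p" and x: "x < k + 2" using v by auto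
    then have s: "j \<le> (k - 1) * p" "l < k" "slot k p j l = Gadget j l 0"
      by (auto simp: gadget_slots_def)
    have G: "(Stem 0, Gadget j l y) \<in> ?R"
      if "(Stem 0, Gadget j l z) \<in> ?R" "gadget_adj z y" "z < k + 2" "y < k + 2" for y z
      by (rule step[OF that(1)]) (use that jl in auto)
    have "Gadget j l 0 \<in> slot k p j ` {..<k}" using s by (metis imageI lessThan_iff)
    then have 0: "(Stem 0, Gadget j l 0) \<in> ?R" 
      using s stem step[of "Stem j" "Gadget j l 0"] by simp
    have 3: "(Stem 0, Gadget j l y) \<in> ?R" if "3 \<le> y" "y < k + 2" for y
      by (rule G[OF 0]) (use that in \<open>auto simp: gadget_adj_def\<close>)
    consider "x = 0" | "x = 1 \<or> x = 2" | "x \<ge> 3" by linarith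
    then show ?thesis
    proof cases
      case 2
      \<comment> \<open>Vertices 1 and 2 are not adjacent to 0 and are reached through vertex
        3.\<close>
      have "(Stem 0, Gadget j l x) \<in> ?R"
        by (rule G[OF 3[of 3]]) (use 2 k x in \<open>auto simp: gadget_adj_def\<close>)
      then show ?thesis using Gadget by simp
    qed (use 0 3 x Gadget in simp_all)
  qed
qed

section \<open>The regular family: counting and the matching number\<close>

lemma card_gadget_slots: "card (gadget_slots k p) = k + k * (k - 2) * p"
proof -
  let ?N = "(k - 1) * p"
  \<comment> \<open>\<open>A\<close> and \<open>B\<close> are the link-bearing slots 0 and 1. They
    number \<open>k * p\<close>, to be taken from all \<open>k * ((k - 1) * p + 1)\<close>
    slots.\<close>
  define A where "A = (\<lambda>j. (j, 0::nat)) ` {..<?N}"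
  define B where "B = (\<lambda>t. ((k - 1) * t, 1::nat)) ` {1..p}"
  have cA: "card A = ?N" unfolding A_def by (subst card_image) (auto simp: inj_on_def)
  have cB: "card B = p" unfolding B_def using k by (subst card_image) (auto simp: inj_on_def)
  have "{..?N} \<times> {..<k} = gadget_slots k p \<union> (A \<union> B)"
  proof (intro equalityI subsetI)
    fix z assume "z \<in> {..?N} \<times> {..<k}"
    then obtain j l where z: "z = (j, l)" "j \<le> ?N" "l < k" by auto
    show "z \<in> gadget_slots k p \<union> (A \<union> B)"
    proof (cases "slot k p j l = Gadget j l 0")
      case True
      then show ?thesis using z by (simp add: gadget_slots_def)
    next
      case False
      then consider "l = 0" "j < ?N" | "l = 1" "0 < j" "(k - 1) dvd j"
        unfolding slot_def by (auto split: if_splits)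
      then show ?thesis
      proof cases
        case 1
        then show ?thesis using z by (auto simp: A_def)
      next
        case 2
        then obtain t where t: "j = (k - 1) * t" "t > 0" by (auto elim: dvdE)
        then have "t \<in> {1..p}" using z(2) k by simp
        then show ?thesis using z(1) 2(1) t(1) unfolding B_def by blast
      qed
    qed
  next
    fix z assume "z \<in> gadget_slots k p \<union> (A \<union> B)"
    then show "z \<in> {..?N} \<times> {..<k}"
      using k by (auto simp: gadget_slots_def A_def B_def)
  qed
  moreover have "gadget_slots k p \<inter> (A \<union> B) = {}"
    using k by (auto simp: gadget_slots_def A_def B_def slot_def)
  moreover have "card (A \<union> B) = ?N + p"
    using cA cB by (subst card_Un_disjoint) (auto simp: A_def B_def)
  moreover have "finite (A \<union> B)" by (simp add: A_def B_def)
  ultimately have "card ({..?N} \<times> {..<k}) = card (gadget_slots k p) + (?N + p)"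
    using finite_gadget_slots by (simp add: card_Un_disjoint)
  then have eq: "(?N + 1) * k = card (gadget_slots k p) + (?N + p)"
    by (simp only: card_cartesian_product card_atMost card_lessThan Suc_eq_plus1)
  obtain q where q: "k = q + 2" using k le_Suc_ex[of 2 k] by auto
  show ?thesis using eq unfolding q by (simp add: algebra_simps)
qed

lemma card_regular_verts:
  "card (regular_verts k p) = (k - 1) * p + 1 + p + (k + 2) * (k + k * (k - 2) * p)"
proof -
  let ?C = "(\<lambda>((j, l), x). Gadget j l x) ` (gadget_slots k p \<times> {..<k + 2})"
  have "card ?C = card (gadget_slots k p \<times> {..<k + 2})" by (rule card_image) (auto simp: inj_on_def)
  then have "card ?C = (k + 2) * (k + k * (k - 2) * p)"
    by (simp add: card_cartesian_product card_gadget_slots)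
  moreover have "card (Stem ` {..(k - 1) * p} \<union> Link ` {..<p}) = (k - 1) * p + 1 + p"
    by (subst card_Un_disjoint) (auto simp: card_image inj_on_def)
  moreover have "(Stem ` {..(k - 1) * p} \<union> Link ` {..<p}) \<inter> ?C = {}" by auto
  ultimately show ?thesis
    unfolding regular_verts_def using finite_gadget_slots by (subst card_Un_disjoint) auto
qed

text \<open>The stems are the separator: a link stands alone and counts \<open>1 div 2 = 0\<close>,
  and a gadget of odd order \<open>k + 2\<close> counts \<open>(k + 1) div 2\<close>.\<close>

lemma matching_number_regular_graph_le:
  "matching_number (regular_graph k p)
    \<le> (k - 1) * p + 1 + (k + k * (k - 2) * p) * ((k + 1) div 2)"
proof -
  let ?G = "regular_graph k p"
  define S where "S = Stem ` {..(k - 1) * p}"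
  \<comment> \<open>A gadget is labelled by its vertex 0 and a link by itself; outside
    \<open>S\<close> every edge stays inside one gadget.\<close>
  define c where "c v = (case v of Gadget j l x \<Rightarrow> Gadget j l 0 | _ \<Rightarrow> v)" for v
  define I where "I = Link ` {..<p}"
  define J where "J = (\<lambda>(j, l). Gadget j l 0) ` gadget_slots k p"
  define h where "h i = card {v \<in> verts ?G - S. c v = i} div 2" for i
  have cS: "card S = (k - 1) * p + 1" unfolding S_def by (subst card_image) (auto simp: inj_on_def)
  have "matching_number ?G \<le> card S + (\<Sum>i\<in>I \<union> J. card {v \<in> verts ?G - S. c v = i} div 2)"
  proof (rule matching_number_le_separator[OF finite_regular_graph])
    show "finite S" "finite (I \<union> J)" using finite_gadget_slots by (auto simp: S_def I_def J_def)
    show "c ` (verts ?G - S) \<subseteq> I \<union> J"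
    proof
      fix i assume "i \<in> c ` (verts ?G - S)"
      then obtain v where v: "v \<in> regular_verts k p" "v \<notin> S" "i = c v" by auto
      then show "i \<in> I \<union> J"
        by (cases v) (auto simp: c_def S_def I_def J_def)
    qed
    fix u v assume uv: "{u, v} \<in> edges ?G" "u \<notin> S" "v \<notin> S"
    then have "u \<in> regular_verts k p" "v \<in> nbs k p u" "v \<in> regular_verts k p"
      using nbs_sym by (auto simp: regular_graph_edge)
    moreover from this have "u \<notin> range Stem" "v \<notin> range Stem" using uv(2,3) by (auto simp: S_def)
    ultimately show "c u = c v" by (cases u) (auto simp: c_def split: if_splits)
  qed
  also have "\<dots> = card S + sum h (I \<union> J)" by (simp add: h_def)
  also have "sum h (I \<union> J) \<le> sum h I + sum h J"
    using finite_gadget_slots by (simp add: sum_Un_nat I_def J_def)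
  also have "sum h I = 0"
  proof (rule sum.neutral, rule ballI)
    fix i assume "i \<in> I"
    have "v = i" if "v \<in> verts ?G - S" "c v = i" for v
      using \<open>i \<in> I\<close> that by (cases v) (auto simp: I_def c_def S_def)
    then have "{v \<in> verts ?G - S. c v = i} \<subseteq> {i}" by auto
    then have "card {v \<in> verts ?G - S. c v = i} \<le> card {i}" by (intro card_mono) auto
    then show "h i = 0" by (simp add: h_def)
  qed
  also have "sum h J \<le> (\<Sum>i\<in>J. (k + 1) div 2)"
  proof (rule sum_mono)
    fix i assume "i \<in> J"
    then obtain j l where i: "i = Gadget j l 0" by (auto simp: J_def)
    have "v \<in> Gadget j l ` {..<k + 2}" if "v \<in> verts ?G - S" "c v = i" for v
      using i that by (cases v) (auto simp: c_def S_def)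
    then have "{v \<in> verts ?G - S. c v = i} \<subseteq> Gadget j l ` {..<k + 2}" by auto
    then have "card {v \<in> verts ?G - S. c v = i} \<le> card (Gadget j l ` {..<k + 2})"
      by (intro card_mono) auto
    also have "\<dots> \<le> k + 2" using card_image_le[of "{..<k + 2}" "Gadget j l"] by simp
    finally have "h i \<le> (k + 2) div 2" unfolding h_def by (rule div_le_mono)
    also have "(k + 2) div 2 = (k + 1) div 2" using k(2) by (auto elim: oddE)
    finally show "h i \<le> (k + 1) div 2" .
  qed
  also have "\<dots> = card J * ((k + 1) div 2)" by simp
  also have "card J = k + k * (k - 2) * p"
    unfolding J_def card_gadget_slots[symmetric] by (rule card_image) (auto simp: inj_on_def)
  finally show ?thesis using cS by simp
qed

text \<open>Regularity gives \<open>2 * m = n * k\<close>; after multiplication by \<open>K\<close>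
  the claim is a polynomial identity in \<open>k\<close> and \<open>p\<close>.\<close>

lemma regular_graph_bound:
  "matching_bound k (card (regular_verts k p)) (card (edges (regular_graph k p)))
    = real ((k - 1) * p + 1 + (k + k * (k - 2) * p) * ((k + 1) div 2))"
proof -
  define n where "n = card (regular_verts k p)"
  define m where "m = card (edges (regular_graph k p))"
  define r where "r = real k"
  have r: "r \<ge> 3" using k by (simp add: r_def)
  have "2 * m = (\<Sum>v\<in>regular_verts k p. vdegree (regular_graph k p) v)"
    using handshake[OF finite_regular_graph] by (simp add: m_def)
  also have "\<dots> = n * k" using vdegree_regular_graph by (simp add: n_def)
  finally have "2 * real m = real n * r" unfolding r_def by (metis of_nat_mult of_nat_numeral)
  then have m: "real m = real n * r / 2" by simp
  have k1: "real (k - 1) = r - 1" "real (k - 2) = r - 2" using k by (auto simp: r_def of_nat_diff)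
  have n: "real n = (r - 1) * real p + 1 + real p + (r + 2) * (r + r * (r - 2) * real p)"
    unfolding n_def card_regular_verts of_nat_add of_nat_mult k1 by (simp add: r_def)
  have "2 * ((k + 1) div 2) = k + 1" using k(2) by (auto elim: oddE)
  then have "2 * real ((k + 1) div 2) = r + 1" unfolding r_def by (metis of_nat_mult of_nat_numeral of_nat_add of_nat_1)
  then have half: "real ((k + 1) div 2) = (r + 1) / 2" by simp
  define K where "K = r * (r\<^sup>2 - 3)"
  have "r * r \<ge> 3 * r" using r by simp
  then have "r\<^sup>2 - 3 > 0" using r unfolding power2_eq_square by linarith
  then have K: "K > 0" using r by (simp add: K_def)
  have "matching_bound k n m = ((r - 1) * real n + (r\<^sup>2 - r - 2) * real m - (r - 1)) / K"
    unfolding matching_bound_def r_def[symmetric] K_def[symmetric]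
    by (simp only: times_divide_eq_left flip: add_divide_distrib diff_divide_distrib)
  also have "(r - 1) * real n + (r\<^sup>2 - r - 2) * real m - (r - 1)
      = ((r - 1) * real p + 1 + (r + r * (r - 2) * real p) * ((r + 1) / 2)) * K"
    unfolding m n K_def by (simp add: field_simps power2_eq_square)
  also have "\<dots> / K = (r - 1) * real p + 1 + (r + r * (r - 2) * real p) * ((r + 1) / 2)"
    using K by simp
  also have "\<dots> = real ((k - 1) * p + 1 + (k + k * (k - 2) * p) * ((k + 1) div 2))"
    by (simp add: k1 half r_def[symmetric])
  finally show ?thesis by (simp add: n_def m_def)
qed

lemma matching_number_regular_graph:
  "real (matching_number (regular_graph k p))
    = matching_bound k (card (regular_verts k p)) (card (edges (regular_graph k p)))"
proof (rule antisym)
  show "real (matching_number (regular_graph k p))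
      \<le> matching_bound k (card (regular_verts k p)) (card (edges (regular_graph k p)))"
    unfolding regular_graph_bound using matching_number_regular_graph_le by (rule of_nat_mono)
  show "matching_bound k (card (regular_verts k p)) (card (edges (regular_graph k p)))
      \<le> real (matching_number (regular_graph k p))"
    using matching_number_lower_bound[OF k simple_regular_graph connected_regular_graph]
      vdegree_regular_graph by simp
qed

end

lemma infinitely_many_extremal_regular_graphs:
  assumes k: "k \<ge> 3" "odd k"
  shows "infinitely_many_graphs (\<lambda>G. simple_graph G \<and> connected_graph G \<and> regular k G \<and>
    real (matching_number G) = matching_bound k (card (verts G)) (card (edges G)))"
proof (rule infinitely_many_graphsI)
  fix p
  have inj: "inj (to_nat :: vertex \<Rightarrow> nat)" by (rule inj_to_nat)
  let ?G = "image_graph to_nat (regular_graph k p)"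
  have "regular k ?G"
    using vdegree_regular_graph[OF k]
    by (auto simp: regular_def vdegree_image_graph[OF inj] verts_regular_graph[OF k])
  moreover have "real (matching_number ?G) = matching_bound k (card (verts ?G)) (card (edges ?G))"
    unfolding matching_number_image_graph[OF inj] card_image_graph[OF inj]
    using matching_number_regular_graph[OF k] verts_regular_graph[OF k] by simp
  ultimately show "simple_graph ?G \<and> connected_graph ?G \<and> regular k ?G \<and>
      real (matching_number ?G) = matching_bound k (card (verts ?G)) (card (edges ?G))"
    using simple_image_graph[OF inj simple_regular_graph[OF k]]
      connected_image_graph[OF inj connected_regular_graph[OF k]] by blast
next
  have inj: "inj (to_nat :: vertex \<Rightarrow> nat)" by (rule inj_to_nat)
  \<comment> \<open>\<open>d\<close> is the slope of the order, which is affine in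
    \<open>p\<close>.\<close>
  define d where "d = k + (k + 2) * (k * (k - 2))"
  have "card (verts (image_graph to_nat (regular_graph k p))) = 1 + (k + 2) * k + d * p" for p
  proof -
    have "(k - 1) * p + p = k * p" using k by (cases k) simp_all
    then show ?thesis
      unfolding card_image_graph[OF inj] verts_regular_graph[OF k] card_regular_verts[OF k] d_def
      by (simp add: algebra_simps)
  qed
  moreover have "d > 0" using k by (simp add: d_def)
  ultimately show "inj (\<lambda>p. card (verts (image_graph to_nat (regular_graph k p))))"
    by (simp add: inj_def)
qed

theorem theoremB:
  fixes k :: nat
  assumes "k \<ge> 3" and "odd k"
  shows "(\<forall>(G :: 'a ugraph) n m. simple_graph G \<longrightarrow> connected_graph G \<longrightarrow>
            n = card (verts G) \<longrightarrow> m = card (edges G) \<longrightarrow> max_degree G \<le> k \<longrightarrow>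
            real (matching_number G) \<ge> matching_bound k n m)
    \<and> infinitely_many_graphs (\<lambda>T. tree T \<and> max_degree T \<le> k \<and>
          real (matching_number T) = matching_bound k (card (verts T)) (card (edges T)))
    \<and> infinitely_many_graphs (\<lambda>G. simple_graph G \<and> connected_graph G \<and> regular k G \<and>
          real (matching_number G) = matching_bound k (card (verts G)) (card (edges G)))"
proof -
  have "real (matching_number G) \<ge> matching_bound k (card (verts G)) (card (edges G))"
    if G: "simple_graph G" "connected_graph G" "max_degree G \<le> k" for G :: "'a ugraph"
  proof (rule matching_number_lower_bound[OF assms G(1,2)])
    fix v assume "v \<in> verts G"
    then have "vdegree G v \<le> max_degree G"
      unfolding max_degree_def using G(1) by (intro Max_ge) (auto simp: simple_graph_def)
    then show "vdegree G v \<le> k" using G(3) by simp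
  qed
  then show ?thesis
    using infinitely_many_extremal_trees[OF assms] infinitely_many_extremal_regular_graphs[OF assms]
    by simp
qed

end
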